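(* Let $\pi$ be an irreducible polynomial in $\mathbf F_r[T]$ of degree $d$, let $\mathcal O=\mathbf F_\pi[[\pi]]$ be the completion of $\mathbf F_r[T]$ at $\pi$, and let $K$ be its fraction field. The hyperdifferential functions $\mathcal D_{j,T}$ on $\mathbf F_r[T]$, extended by continuity to $\mathcal O$, form an orthonormal basis of the space of continuous $\mathbf F_\pi$-linear functions from $\mathcal O$ to $K$. Moreover, the extension of the sequence $\{\mathcal D_{j,T}\}_{j\ge0}$ by $r^d$-digit expansions is an orthonormal basis of $C(\mathcal O,K)$.
   Context: $\mathbf F_\pi=\mathbf F_r[T]/(\pi)$ is the residue field, a field of size $r^d$, which is identified with the unique coefficient field of $\mathcal O$ (so $\mathcal O\cong\mathbf F_\pi[[\pi]]$). $\mathcal D_{j,T}$ is the $\mathbf F_r$-linear map on $\mathbf F_r[T]$ with $\mathcal D_{j,T}(T^m)=\binom{m}{j}T^{m-j}$; it is $\pi$-adically continuous and extends by continuity to $\mathcal O$. $C(\mathcal O,K)$ is the $K$-Banach space of continuous functions $\mathcal O\to K$ with the sup-norm, and the continuous $\mathbf F_\pi$-linear maps form a closed subspace. An orthonormal basis of a $K$-Banach space $E$ is a sequence $\{f_n\}$ such that every $x\in E$ is $x=\sum c_nf_n$ with $c_n\in K$, $c_n\to0$, $\|x\|=\max|c_n|$. Extension by $Q$-digits ($Q=r^d$) of a sequence $(e_j)$: for $i=c_0+c_1Q+\dots+c_{n-1}Q^{n-1}$ with $0\le c_j\le Q-1$, the function $e_0^{c_0}\cdots e_{n-1}^{c_{n-1}}$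 (pointwise product, $e_j^0=1$). *)

theory Defs
  imports "HOL-Computational_Algebra.Computational_Algebra"
begin

definition hyperdiff :: "nat \<Rightarrow> 'a::field poly \<Rightarrow> 'a poly" where
  "hyperdiff j p = (\<Sum>m\<le>degree p. monom (of_nat (m choose j) * coeff p m) (m - j))"

definition nonarch_absval :: "('k::field \<Rightarrow> real) \<Rightarrow> bool" where
  "nonarch_absval av \<longleftrightarrow>
     (\<forall>x. av x \<ge> 0) \<and> (\<forall>x. av x = 0 \<longleftrightarrow> x = 0) \<and>
     (\<forall>x y. av (x * y) = av x * av y) \<and>
     (\<forall>x y. av (x + y) \<le> max (av x) (av y))"

definition av_converges :: "('k::field \<Rightarrow> real) \<Rightarrow> (nat \<Rightarrow> 'k) \<Rightarrow> 'k \<Rightarrow> bool" where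
  "av_converges av s l \<longleftrightarrow> (\<forall>e>0. \<exists>N. \<forall>n\<ge>N. av (s n - l) < e)"

definition av_cauchy :: "('k::field \<Rightarrow> real) \<Rightarrow> (nat \<Rightarrow> 'k) \<Rightarrow> bool" where
  "av_cauchy av s \<longleftrightarrow> (\<forall>e>0. \<exists>N. \<forall>m\<ge>N. \<forall>n\<ge>N. av (s m - s n) < e)"

definition pi_val :: "'a::field poly \<Rightarrow> 'a poly \<Rightarrow> nat" where
  "pi_val \<pi> p = (GREATEST k. \<pi> ^ k dvd p)"

text \<open>K together with an embedding iota of F_r[T] is (a model of) the completion of
  F_r(T) at the irreducible polynomial pi: K is complete for a non-archimedean absolute
  value av, iota is an injective ring homomorphism whose image has the pi-adic absolute value
  (|p| = |pi|^{v_pi(p)}, 0 < |pi| < 1), and iota(F_r(T)) is dense in K.  This characterizes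
  the pi-adic completion up to unique isometric isomorphism.\<close>
definition pi_adic_completion ::
  "'a::{finite,field} poly \<Rightarrow> ('k::field \<Rightarrow> real) \<Rightarrow> ('a poly \<Rightarrow> 'k) \<Rightarrow> bool" where
  "pi_adic_completion \<pi> av \<iota> \<longleftrightarrow>
     nonarch_absval av \<and>
     \<iota> 1 = 1 \<and> (\<forall>p q. \<iota> (p + q) = \<iota> p + \<iota> q) \<and> (\<forall>p q. \<iota> (p * q) = \<iota> p * \<iota> q) \<and>
     inj \<iota> \<and>
     0 < av (\<iota> \<pi>) \<and> av (\<iota> \<pi>) < 1 \<and>
     (\<forall>p. p \<noteq> 0 \<longrightarrow> av (\<iota> p) = av (\<iota> \<pi>) ^ pi_val \<pi> p) \<and>
     (\<forall>s. av_cauchy av s \<longrightarrow> (\<exists>l. av_converges av s l)) \<and>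
     (\<forall>x e. e > 0 \<longrightarrow> (\<exists>p q. q \<noteq> 0 \<and> av (x - \<iota> p / \<iota> q) < e))"

definition val_ring :: "('k::field \<Rightarrow> real) \<Rightarrow> 'k set" where
  "val_ring av = {x. av x \<le> 1}"

text \<open>The coefficient field F_pi inside O: the roots of X^Q - X, Q = r^d
  (zero together with the Teichmueller representatives).\<close>
definition coeff_field :: "nat \<Rightarrow> 'k::field set" where
  "coeff_field Q = {x. x ^ Q = x}"

definition av_continuous_on :: "('k::field \<Rightarrow> real) \<Rightarrow> 'k set \<Rightarrow> ('k \<Rightarrow> 'k) \<Rightarrow> bool" where
  "av_continuous_on av S f \<longleftrightarrow>
     (\<forall>x\<in>S. \<forall>e>0. \<exists>\<delta>>0. \<forall>y\<in>S. av (y - x) < \<delta> \<longrightarrow> av (f y - f x) < e)"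

definition cont_fun_space :: "('k::field \<Rightarrow> real) \<Rightarrow> ('k \<Rightarrow> 'k) set" where
  "cont_fun_space av = {f. av_continuous_on av (val_ring av) f}"

definition cont_lin_space :: "('k::field \<Rightarrow> real) \<Rightarrow> nat \<Rightarrow> ('k \<Rightarrow> 'k) set" where
  "cont_lin_space av Q = {f. av_continuous_on av (val_ring av) f \<and>
      (\<forall>x\<in>val_ring av. \<forall>y\<in>val_ring av. f (x + y) = f x + f y) \<and>
      (\<forall>c\<in>coeff_field Q. \<forall>x\<in>val_ring av. f (c * x) = c * f x)}"

definition sup_norm :: "('k::field \<Rightarrow> real) \<Rightarrow> ('k \<Rightarrow> 'k) \<Rightarrow> real" where
  "sup_norm av f = (SUP x\<in>val_ring av. av (f x))"

definition orthonormal_basis ::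
  "('k::field \<Rightarrow> real) \<Rightarrow> ('k \<Rightarrow> 'k) set \<Rightarrow> (nat \<Rightarrow> 'k \<Rightarrow> 'k) \<Rightarrow> bool" where
  "orthonormal_basis av E e \<longleftrightarrow>
     (\<forall>n. e n \<in> E) \<and>
     (\<forall>f\<in>E. \<exists>c::nat \<Rightarrow> 'k.
        av_converges av c 0 \<and>
        (\<forall>\<epsilon>>0. \<exists>N0. \<forall>N\<ge>N0. \<forall>x\<in>val_ring av. av (f x - (\<Sum>n<N. c n * e n x)) < \<epsilon>) \<and>
        sup_norm av f = (SUP n. av (c n)))"

definition hyperdiff_ext :: "('k::field \<Rightarrow> real) \<Rightarrow> ('a::field poly \<Rightarrow> 'k) \<Rightarrow> nat \<Rightarrow> 'k \<Rightarrow> 'k" where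
  "hyperdiff_ext av \<iota> j = (SOME g. av_continuous_on av (val_ring av) g \<and>
        (\<forall>p. g (\<iota> p) = \<iota> (hyperdiff j p)))"

definition digit_ext :: "nat \<Rightarrow> (nat \<Rightarrow> 'k \<Rightarrow> 'k::comm_ring_1) \<Rightarrow> nat \<Rightarrow> 'k \<Rightarrow> 'k" where
  "digit_ext Q e i x = (\<Prod>j\<le>i. e j x ^ ((i div Q ^ j) mod Q))"

end

theory Submission
  imports Defs "HOL-Algebra.Sylow"
begin

text \<open>Let \<open>\<theta>\<close> be the Teichmueller representative of \<open>T\<close>. Then \<open>t = T - \<theta>\<close> is a uniformizer, and the
  power series \<open>\<Sum>\<^sub>j D\<^sub>j(x) X\<^sup>j\<close> is multiplicative in \<open>x\<close>, constant for \<open>x\<close> in the coefficient field and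
  equal to \<open>t + X\<close> for \<open>x = t\<close>. So \<open>D\<^sub>j\<close> is the Hasse derivative with respect to \<open>t\<close>, and modulo the
  maximal ideal it picks out the \<open>j\<close>-th \<open>t\<close>-adic digit. A continuous linear function is therefore
  approximated, up to a factor \<open>\<rho> < 1\<close> of its norm, by a finite combination of the \<open>D\<^sub>j\<close>; a
  continuous function is approximated in the same way after expanding indicators of residue classes
  as polynomials in the digits. Iterating the approximation gives both orthonormal bases.\<close>

section \<open>Finite fields and Fermat's theorem for polynomials\<close>

text \<open>For \<open>degree \<pi> > 1\<close> the coefficient field is not contained in the
  polynomial ring, while hyperderivatives are defined by their effect on powers of \<open>T\<close>.
  So neither linearity over that field nor the effect on digits can be read off from the definition,
  and powers of \<open>\<pi>\<close> have no simple hyperderivatives. Shifting \<open>T\<close> by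
  \<open>\<theta>\<close> cures both defects, but \<open>\<theta>\<close> exists only as a limit.
  This is why the functions must be extended to the valuation ring, together with their Leibniz
  rule, before any digit can be computed. Additivity of Frobenius powers carries both the
  construction of \<open>\<theta>\<close> and the constancy of the series on the coefficient field,
  and it needs the size of the finite field to be a power of the characteristic. The factor
  \<open>\<rho>\<close> is the absolute value of \<open>\<pi>\<close>, which is also that of
  \<open>t\<close>: a congruence modulo the maximal ideal is an error of at most
  \<open>\<rho>\<close>, so one round of approximation only has to be correct on residues.\<close>

lemma finite_field_prime_dvd_card:
  assumes "prime l" "l dvd card (UNIV :: 'a::{finite,field} set)"
  shows "l = CHAR('a)"
proof -
  define G where "G = \<lparr>carrier = (UNIV :: 'a set), monoid.mult = (+), one = (0 :: 'a)\<rparr>"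
  interpret group G
    by (rule groupI) (auto simp: G_def add.assoc intro: exI[of _ "- x" for x])
  obtain m where m: "card (UNIV :: 'a set) = l ^ 1 * m" using assms by auto
  \<comment> \<open>Sylow's theorem with exponent 1 is Cauchy's theorem for the additive
    group.\<close>
  have "\<exists>H. subgroup H G \<and> card H = l ^ 1"
    using assms(1) m
    by (intro sylow_thm[where m = m]) (auto simp: order_def G_def[symmetric] intro: group_axioms, auto simp: G_def)
  then obtain H where H: "subgroup H G" "card H = l" by auto
  have "l > 1" using assms(1) prime_gt_1_nat by blast
  have "\<not> H \<subseteq> {0}"
  proof
    assume "H \<subseteq> {0}"
    then have "card H \<le> card {0 :: 'a}" by (intro card_mono) auto
    then show False using H(2) \<open>l > 1\<close> by simp
  qed
  then obtain x where x: "x \<in> H" "x \<noteq> 0" by auto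
  \<comment> \<open>Translation by \<open>x\<close> permutes \<open>H\<close>; comparing the two
    sums over \<open>H\<close> gives \<open>l * x = 0\<close>, hence \<open>l = 0\<close> in the
    field.\<close>
  have "bij_betw (\<lambda>h. h + x) H H"
  proof (rule bij_betwI[where g = "\<lambda>h. h - x"])
    have "- x \<in> H"
      using subgroup.m_inv_closed[OF H(1) x(1)] inv_equality[of "- x" x] by (simp add: G_def)
    then show "(\<lambda>h. h - x) \<in> H \<rightarrow> H"
      using subgroup.m_closed[OF H(1)] by (fastforce simp: G_def)
    show "(\<lambda>h. h + x) \<in> H \<rightarrow> H"
      using subgroup.m_closed[OF H(1)] x(1) by (auto simp: G_def)
  qed auto
  then have "(\<Sum>h\<in>H. h) = (\<Sum>h\<in>H. h + x)"
    by (rule sum.reindex_bij_betw[symmetric])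
  also have "\<dots> = (\<Sum>h\<in>H. h) + of_nat l * x" using H(2) by (simp add: sum.distrib)
  finally have "of_nat l = (0 :: 'a)" using x(2) by simp
  then have "CHAR('a) dvd l" by (simp add: of_nat_eq_0_iff_char_dvd)
  then show ?thesis
    using assms(1) by (metis CHAR_not_1' prime_nat_iff One_nat_def)
qed

lemma prime_CHAR_finite: "prime CHAR('a::{finite,field})"
  by (rule prime_CHAR_semidom) (simp add: finite_imp_CHAR_pos)

text \<open>Needed so that raising to the power \<open>Q ^ n\<close> is additive, both in
  \<open>K\<close> and in its power series.\<close>

lemma finite_field_card_CHAR_power:
  "\<exists>e. card (UNIV :: 'a::{finite,field} set) = CHAR('a) ^ e"
proof -
  let ?r = "card (UNIV :: 'a set)" and ?p = "CHAR('a)"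
  have "?r \<noteq> 0" by simp
  moreover have "\<not> is_unit ?p" using prime_CHAR_finite[where 'a = 'a] not_prime_unit by blast
  ultimately obtain m where m: "?r = ?p ^ multiplicity ?p ?r * m" "\<not> ?p dvd m"
    using multiplicity_decompose'[of ?r ?p] by metis
  have "m = 1"
  proof (rule ccontr)
    assume "m \<noteq> 1"
    then obtain l where l: "prime l" "l dvd m" using prime_factor_nat by blast
    then have "l dvd ?r" by (subst m(1)) simp
    from finite_field_prime_dvd_card[OF l(1) this] show False using l(2) m(2) by simp
  qed
  then show ?thesis using m(1) by (intro exI[of _ "multiplicity ?p ?r"]) simp
qed

lemma card_degree_less:
  assumes "d > 0"
  shows "card {p :: 'a::{finite,field} poly. degree p < d} = card (UNIV :: 'a set) ^ d"
    and "finite {p :: 'a::{finite,field} poly. degree p < d}"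
proof -
  let ?L = "{xs :: 'a list. set xs \<subseteq> UNIV \<and> length xs = d}"
  have bij: "bij_betw Poly ?L {p. degree p < d}"
  proof (rule bij_betw_byWitness[where f' = "\<lambda>p :: 'a poly. map (coeff p) [0..<d]"])
    show "\<forall>xs\<in>?L. map (coeff (Poly xs)) [0..<d] = xs"
      by (auto intro!: nth_equalityI simp: nth_default_def)
    show "\<forall>p\<in>{p. degree p < d}. Poly (map (coeff p) [0..<d]) = p"
      by (auto intro!: poly_eqI simp: nth_default_def coeff_eq_0)
    show "Poly ` ?L \<subseteq> {p. degree p < d}"
      using assms by (auto intro!: degree_lessI simp: nth_default_def)
  qed auto
  show "card {p :: 'a poly. degree p < d} = card (UNIV :: 'a set) ^ d"
    using bij_betw_same_card[OF bij] card_lists_length_eq[of "UNIV :: 'a set" d] by simp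
  show "finite {p :: 'a poly. degree p < d}"
    using bij_betw_finite[OF bij] finite_lists_length_eq[of "UNIV :: 'a set" d] by simp
qed

text \<open>Multiplication by \<open>p\<close> permutes the nonzero remainders modulo
  \<open>\<pi>\<close>; their product is prime to \<open>\<pi>\<close> and cancels. The result
  supplies inverses modulo \<open>\<pi>\<close>, the start of the Teichmueller limit, and the fact
  that constants lie in the coefficient field.\<close>

lemma poly_fermat:
  fixes \<pi> p :: "'a::{finite,field} poly"
  assumes "irreducible \<pi>"
  shows "\<pi> dvd p ^ (card (UNIV :: 'a set) ^ degree \<pi>) - p"
proof (cases "\<pi> dvd p")
  case True
  then show ?thesis
    using finite_UNIV_card_ge_0[where 'a = 'a, OF finite] by (intro dvd_diff dvd_trans[OF True dvd_power]) auto
next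
  case False
  let ?Q = "card (UNIV :: 'a set) ^ degree \<pi>"
  have pr: "prime_elem \<pi>" using assms field_poly_irreducible_imp_prime by blast
  have \<pi>0: "\<pi> \<noteq> 0" and d: "degree \<pi> > 0"
    using assms by (auto simp: irreducible_def is_unit_iff_degree)
  define R where "R = {x :: 'a poly. degree x < degree \<pi>} - {0}"
  have cR: "card R = ?Q - 1" and fR: "finite R"
    using card_degree_less[OF d, where 'a = 'a] d by (auto simp: R_def)
  have ndvd: "\<not> \<pi> dvd x" if "x \<in> R" for x
    using that by (auto simp: R_def dest: dvd_imp_degree_le)
  have inj: "inj_on (\<lambda>x. p * x mod \<pi>) R"
  proof (rule inj_onI)
    fix x y assume xy: "x \<in> R" "y \<in> R" "p * x mod \<pi> = p * y mod \<pi>"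
    then have "\<pi> dvd p * (x - y)" by (simp add: mod_eq_dvd_iff algebra_simps)
    then have "\<pi> dvd x - y" using pr False prime_elem_dvd_mult_iff by blast
    moreover have "degree (x - y) < degree \<pi>" using xy by (auto simp: R_def degree_diff_less)
    ultimately show "x = y" by (metis dvd_imp_degree_le not_le right_minus_eq)
  qed
  have "(\<lambda>x. p * x mod \<pi>) ` R \<subseteq> R"
  proof clarify
    fix x assume x: "x \<in> R"
    have "p * x mod \<pi> \<noteq> 0"
      using ndvd[OF x] False pr by (auto simp: mod_eq_0_iff_dvd prime_elem_dvd_mult_iff)
    then show "p * x mod \<pi> \<in> R" using \<pi>0 d by (auto simp: R_def degree_mod_less')
  qed
  then have im: "(\<lambda>x. p * x mod \<pi>) ` R = R" using inj fR by (metis card_image card_subset_eq)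
  have "(\<Prod>x\<in>R. x) mod \<pi> = (\<Prod>x\<in>R. p * x mod \<pi>) mod \<pi>"
    using prod.reindex[OF inj, of "\<lambda>x. x"] im by simp
  also have "\<dots> = (\<Prod>x\<in>R. p * x) mod \<pi>" by (rule mod_prod_eq)
  also have "\<dots> = (p ^ (?Q - 1) * \<Prod>R) mod \<pi>" by (simp add: prod.distrib cR)
  finally have "\<pi> dvd (p ^ (?Q - 1) - 1) * \<Prod>R"
    by (simp add: mod_eq_dvd_iff algebra_simps dvd_diff_commute)
  moreover have "\<not> \<pi> dvd \<Prod>R"
    using fR ndvd
  proof (induction R)
    case empty
    then show ?case using assms by (simp add: irreducible_not_unit)
  next
    case (insert x F)
    then show ?case using pr by (simp add: prime_elem_dvd_mult_iff)
  qed
  ultimately have "\<pi> dvd p ^ (?Q - 1) - 1" using pr prime_elem_dvd_mult_iff by blast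
  then have "\<pi> dvd p * (p ^ (?Q - 1) - 1)" by simp
  moreover have "p * (p ^ (?Q - 1) - 1) = p ^ ?Q - p"
    using finite_UNIV_card_ge_0[where 'a = 'a, OF finite]
    by (simp add: algebra_simps flip: power_Suc)
  ultimately show ?thesis by simp
qed

section \<open>Non-archimedean fields and orthonormal bases\<close>

locale nonarch_field =
  fixes av :: "'k::field \<Rightarrow> real"
  assumes nonarch: "nonarch_absval av"
begin

abbreviation val_ring_O ("\<O>") where "\<O> \<equiv> val_ring av"

lemma mem_O: "x \<in> \<O> \<longleftrightarrow> av x \<le> 1"
  by (simp add: val_ring_def)

lemma av_nonneg [simp]: "0 \<le> av x"
  and av_eq_0_iff [simp]: "av x = 0 \<longleftrightarrow> x = 0"
  and av_mult: "av (x * y) = av x * av y"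
  and av_add_le_max: "av (x + y) \<le> max (av x) (av y)"
  using nonarch by (auto simp: nonarch_absval_def)

lemma av_zero [simp]: "av 0 = 0"
  by simp

lemma av_one [simp]: "av 1 = 1"
  using av_mult[of 1 1] by (metis av_eq_0_iff mult.right_neutral mult_cancel_left2 zero_neq_one)

lemma av_power: "av (x ^ n) = av x ^ n"
  by (induction n) (auto simp: av_mult)

lemma av_minus [simp]: "av (- x) = av x"
proof -
  have "av (- 1) * av (- 1) = 1" using av_mult[of "- 1" "- 1"] by simp
  then have "av (- 1) = 1"
    by (metis av_nonneg power2_eq_square power2_eq_imp_eq power_one zero_le_one)
  then show ?thesis using av_mult[of "- 1" x] by simp
qed

lemma av_diff_commute: "av (x - y) = av (y - x)"
  using av_minus[of "x - y"] by simp

lemma av_add_le: "av x \<le> B \<Longrightarrow> av y \<le> B \<Longrightarrow> av (x + y) \<le> B"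
  using av_add_le_max[of x y] by simp

lemma av_diff_le: "av x \<le> B \<Longrightarrow> av y \<le> B \<Longrightarrow> av (x - y) \<le> B"
  using av_add_le[of x B "- y"] by simp

lemma av_trans_le: "av (x - y) \<le> B \<Longrightarrow> av (y - z) \<le> B \<Longrightarrow> av (x - z) \<le> B"
  using av_add_le[of "x - y" B "y - z"] by simp

lemma av_diff_less: "av x < B \<Longrightarrow> av y < B \<Longrightarrow> av (x - y) < B"
  using av_add_le_max[of x "- y"] by simp

lemma av_sum_le: "(\<And>i. i \<in> A \<Longrightarrow> av (f i) \<le> B) \<Longrightarrow> 0 \<le> B \<Longrightarrow> av (sum f A) \<le> B"
  by (induction A rule: infinite_finite_induct) (auto intro: av_add_le)

lemma av_mult_le: "av x \<le> B \<Longrightarrow> av y \<le> C \<Longrightarrow> av (x * y) \<le> B * C"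
  by (metis av_mult av_nonneg mult_mono order_trans)

lemma av_mult_le_left: "av x \<le> B \<Longrightarrow> av y \<le> 1 \<Longrightarrow> av (x * y) \<le> B"
  using av_mult_le[of x B y 1] by simp

lemma av_mult_le_right: "av x \<le> 1 \<Longrightarrow> av y \<le> B \<Longrightarrow> av (x * y) \<le> B"
  using av_mult_le[of x 1 y B] by simp

lemma av_of_nat_le_1: "av (of_nat n) \<le> 1"
  by (induction n) (auto intro: av_add_le)

lemma O_0 [simp]: "0 \<in> \<O>" and O_1 [simp]: "1 \<in> \<O>"
  by (simp_all add: mem_O)

lemma O_add [intro]: "x \<in> \<O> \<Longrightarrow> y \<in> \<O> \<Longrightarrow> x + y \<in> \<O>"
  and O_diff [intro]: "x \<in> \<O> \<Longrightarrow> y \<in> \<O> \<Longrightarrow> x - y \<in> \<O>"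
  and O_mult [intro]: "x \<in> \<O> \<Longrightarrow> y \<in> \<O> \<Longrightarrow> x * y \<in> \<O>"
  and O_power [intro]: "x \<in> \<O> \<Longrightarrow> x ^ n \<in> \<O>"
  by (auto simp: mem_O av_add_le av_diff_le av_mult_le_left av_power power_le_one)

lemma O_sum [intro]: "(\<And>i. i \<in> A \<Longrightarrow> f i \<in> \<O>) \<Longrightarrow> sum f A \<in> \<O>"
  by (auto simp: mem_O intro: av_sum_le)

lemma O_minus [intro]: "x \<in> \<O> \<Longrightarrow> - x \<in> \<O>"
  and O_of_nat [intro]: "of_nat n \<in> \<O>"
  by (simp_all add: mem_O av_of_nat_le_1)

lemma O_prod [intro]: "(\<And>i. i \<in> A \<Longrightarrow> f i \<in> \<O>) \<Longrightarrow> prod f A \<in> \<O>"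
  by (induction A rule: infinite_finite_induct) auto

text \<open>Closed balls around 0 are \<open>\<O>\<close>-modules, so congruences modulo such a ball
  survive products of integral elements. Powers and finite products follow by induction.\<close>

lemma av_diff_mult_le:
  assumes "av (x - x') \<le> B" "av (y - y') \<le> B" "x \<in> \<O>" "y' \<in> \<O>"
  shows "av (x * y - x' * y') \<le> B"
proof -
  have "x * y - x' * y' = x * (y - y') + (x - x') * y'" by (simp add: algebra_simps)
  moreover have "av (x * (y - y')) \<le> B" "av ((x - x') * y') \<le> B"
    using assms by (auto simp: mem_O intro: av_mult_le_left av_mult_le_right)
  ultimately show ?thesis using av_add_le by simp
qed

lemma av_diff_power_le:
  assumes "av (x - x') \<le> B" "x \<in> \<O>" "x' \<in> \<O>"
  shows "av (x ^ n - x' ^ n) \<le> B"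
proof (induction n)
  case 0
  show ?case using order_trans[OF av_nonneg assms(1)] by simp
next
  case (Suc n)
  then show ?case using av_diff_mult_le[OF assms(1) Suc.IH] assms by auto
qed

lemma av_diff_prod_le:
  assumes "0 \<le> B" "\<And>i. i \<in> A \<Longrightarrow> av (f i - g i) \<le> B" "\<And>i. i \<in> A \<Longrightarrow> f i \<in> \<O>"
    "\<And>i. i \<in> A \<Longrightarrow> g i \<in> \<O>"
  shows "av (prod f A - prod g A) \<le> B \<and> prod g A \<in> \<O>"
  using assms(2-)
proof (induction A rule: infinite_finite_induct)
  case (insert x F)
  then show ?case by (auto intro!: av_diff_mult_le)
qed (use assms(1) in auto)

lemma av_eq_0_if_small: "(\<And>e. e > 0 \<Longrightarrow> av x \<le> e) \<Longrightarrow> x = 0"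
  using field_le_epsilon[of "av x" 0] by (metis add_0 av_eq_0_iff av_nonneg order_antisym)

lemma av_continuous_onI:
  assumes "\<And>x e. x \<in> \<O> \<Longrightarrow> e > 0 \<Longrightarrow> \<exists>\<delta>>0. \<forall>y\<in>\<O>. av (y - x) < \<delta> \<longrightarrow> av (f y - f x) \<le> e"
  shows "av_continuous_on av \<O> f"
  unfolding av_continuous_on_def
proof (intro ballI allI impI)
  fix x e :: _ assume "x \<in> \<O>" "(e :: real) > 0"
  then obtain \<delta> where "\<delta> > 0" "\<forall>y\<in>\<O>. av (y - x) < \<delta> \<longrightarrow> av (f y - f x) \<le> e / 2"
    using assms[of x "e / 2"] by auto
  then show "\<exists>\<delta>>0. \<forall>y\<in>\<O>. av (y - x) < \<delta> \<longrightarrow> av (f y - f x) < e"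
    using \<open>e > 0\<close> by (intro exI[of _ \<delta>]) force
qed

lemma av_continuous_onD:
  assumes "av_continuous_on av \<O> f" "x \<in> \<O>" "e > 0"
  obtains \<delta> where "\<delta> > 0" "\<And>y. y \<in> \<O> \<Longrightarrow> av (y - x) < \<delta> \<Longrightarrow> av (f y - f x) < e"
  using assms unfolding av_continuous_on_def by blast

lemma av_continuous_on_const: "av_continuous_on av \<O> (\<lambda>x. c)"
  by (auto simp: av_continuous_on_def intro: exI[of _ 1])

lemma av_continuous_on_diff:
  assumes "av_continuous_on av \<O> f" "av_continuous_on av \<O> g"
  shows "av_continuous_on av \<O> (\<lambda>x. f x - g x)"
  unfolding av_continuous_on_def
proof (intro ballI allI impI)
  fix x e :: _ assume x: "x \<in> \<O>" and e: "(e :: real) > 0"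
  obtain d1 where d1: "d1 > 0" "\<And>y. y \<in> \<O> \<Longrightarrow> av (y - x) < d1 \<Longrightarrow> av (f y - f x) < e"
    using av_continuous_onD[OF assms(1) x e] by blast
  obtain d2 where d2: "d2 > 0" "\<And>y. y \<in> \<O> \<Longrightarrow> av (y - x) < d2 \<Longrightarrow> av (g y - g x) < e"
    using av_continuous_onD[OF assms(2) x e] by blast
  show "\<exists>\<delta>>0. \<forall>y\<in>\<O>. av (y - x) < \<delta> \<longrightarrow> av (f y - g y - (f x - g x)) < e"
  proof (intro exI[of _ "min d1 d2"] conjI ballI impI)
    fix y assume "y \<in> \<O>" "av (y - x) < min d1 d2"
    then have "av ((f y - f x) - (g y - g x)) < e"
      using d1(2)[of y] d2(2)[of y] by (intro av_diff_less[of "f y - f x"]) auto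
    then show "av (f y - g y - (f x - g x)) < e" by (simp add: algebra_simps)
  qed (use d1 d2 in auto)
qed

lemma av_continuous_on_mult:
  assumes "av_continuous_on av \<O> f" "av_continuous_on av \<O> g"
  shows "av_continuous_on av \<O> (\<lambda>x. f x * g x)"
proof (rule av_continuous_onI)
  fix x e :: _ assume x: "x \<in> \<O>" and e: "(e :: real) > 0"
  define M where "M = max 1 (max (av (f x)) (av (g x)))"
  have M: "1 \<le> M" "av (f x) \<le> M" "av (g x) \<le> M" by (auto simp: M_def)
  \<comment> \<open>The bound 1 keeps \<open>g y\<close> below \<open>M\<close> near
    \<open>x\<close>; the bound \<open>e / M\<close> pays for multiplying a difference by a factor
    of size \<open>M\<close>.\<close>
  define e' where "e' = min 1 (e / M)"
  have e': "e' > 0" "e' \<le> 1" "e' * M \<le> e" using e M by (auto simp: e'_def min_def field_simps)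
  obtain d1 where d1: "d1 > 0" "\<And>y. y \<in> \<O> \<Longrightarrow> av (y - x) < d1 \<Longrightarrow> av (f y - f x) < e'"
    using av_continuous_onD[OF assms(1) x e'(1)] by blast
  obtain d2 where d2: "d2 > 0" "\<And>y. y \<in> \<O> \<Longrightarrow> av (y - x) < d2 \<Longrightarrow> av (g y - g x) < e'"
    using av_continuous_onD[OF assms(2) x e'(1)] by blast
  show "\<exists>\<delta>>0. \<forall>y\<in>\<O>. av (y - x) < \<delta> \<longrightarrow> av (f y * g y - f x * g x) \<le> e"
  proof (intro exI[of _ "min d1 d2"] conjI ballI impI)
    fix y assume y: "y \<in> \<O>" "av (y - x) < min d1 d2"
    have 1: "av (f y - f x) \<le> e'" "av (g y - g x) \<le> e'" using d1 d2 y by (auto intro: less_imp_le)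
    have 2: "av (g y) \<le> M"
      using av_add_le[of "g y - g x" M "g x"] 1 M e' by simp
    have "av ((f y - f x) * g y + (g y - g x) * f x) \<le> e' * M"
      using 1 2 M by (intro av_add_le av_mult_le) auto
    moreover have "(f y - f x) * g y + (g y - g x) * f x = f y * g y - f x * g x"
      by (simp add: algebra_simps)
    ultimately show "av (f y * g y - f x * g x) \<le> e" using e' by simp
  qed (use d1 d2 in auto)
qed

lemma av_continuous_on_sum:
  "(\<And>i. i \<in> A \<Longrightarrow> av_continuous_on av \<O> (f i)) \<Longrightarrow> av_continuous_on av \<O> (\<lambda>x. \<Sum>i\<in>A. f i x)"
proof (induction A rule: infinite_finite_induct)
  case (insert i F)
  have "av_continuous_on av \<O> (\<lambda>x. f i x - (0 - (\<Sum>i\<in>F. f i x)))"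
    using insert by (intro av_continuous_on_diff av_continuous_on_const) auto
  then show ?case using insert by simp
qed (auto intro: av_continuous_on_const)

lemma av_continuous_on_power:
  "av_continuous_on av \<O> f \<Longrightarrow> av_continuous_on av \<O> (\<lambda>x. f x ^ n)"
  by (induction n) (auto intro: av_continuous_on_const av_continuous_on_mult)

lemma av_continuous_on_prod:
  "(\<And>i. i \<in> A \<Longrightarrow> av_continuous_on av \<O> (f i)) \<Longrightarrow> av_continuous_on av \<O> (\<lambda>x. \<Prod>i\<in>A. f i x)"
  by (induction A rule: infinite_finite_induct)
    (auto intro: av_continuous_on_const av_continuous_on_mult)

end

locale complete_nonarch_field = nonarch_field +
  assumes complete: "av_cauchy av s \<Longrightarrow> \<exists>l. av_converges av s l"
begin

text \<open>The ultrametric inequality passes the rate \<open>r\<close> to the limit without loss.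
  Every limit in the development is taken through this lemma, since the explicit rate is what is
  used afterwards.\<close>

lemma limit_with_rate:
  assumes close: "\<And>k l. k \<le> l \<Longrightarrow> av (s l - s k) \<le> r k" and r: "r \<longlonglongrightarrow> 0"
  obtains l where "\<And>k. av (l - s k) \<le> r k"
proof -
  have "av_cauchy av s"
    unfolding av_cauchy_def
  proof (intro allI impI)
    fix e :: real assume "e > 0"
    then obtain N where N: "r N < e"
      using order_tendstoD(2)[OF r] eventually_happens'[OF sequentially_bot] by metis
    have "av (s m - s n) < e" if "m \<ge> N" "n \<ge> N" for m n
      using av_trans_le[of "s m" "s N" "r N" "s n"] close[OF that(1)] close[OF that(2)] N
      by (simp add: av_diff_commute)
    then show "\<exists>N. \<forall>m\<ge>N. \<forall>n\<ge>N. av (s m - s n) < e" by blast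
  qed
  then obtain l where l: "av_converges av s l" using complete by blast
  have "av (l - s k) \<le> r k" for k
  proof (rule field_le_epsilon)
    fix e :: real assume "e > 0"
    then obtain N where N: "\<And>n. n \<ge> N \<Longrightarrow> av (s n - l) < e"
      using l unfolding av_converges_def by blast
    let ?n = "max N k"
    have "av (l - s ?n) \<le> r k + e"
      using N[of ?n] order_trans[OF av_nonneg close[of k k]] by (simp add: av_diff_commute)
    moreover have "av (s ?n - s k) \<le> r k + e" using close[of k ?n] \<open>e > 0\<close> by simp
    ultimately show "av (l - s k) \<le> r k + e" by (rule av_trans_le)
  qed
  then show thesis by (rule that)
qed

text \<open>It suffices to approximate every function up to a fixed factor \<open>\<rho> < 1\<close> of its norm by
  combinations whose coefficients do not exceed that norm: iterating yields the expansion, and its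
  coefficients are automatically bounded by the norm.\<close>

lemma orthonormal_basisI:
  assumes e: "\<And>n. e n \<in> E"
    and le1: "\<And>n x. x \<in> \<O> \<Longrightarrow> e n x \<in> \<O>"
    and bdd: "\<And>f. f \<in> E \<Longrightarrow> \<exists>B. \<forall>x\<in>\<O>. av (f x) \<le> B"
    and closed: "\<And>f c N. f \<in> E \<Longrightarrow> (\<lambda>x. f x - (\<Sum>i<N. c i * e i x)) \<in> E"
    and \<rho>: "0 < \<rho>" "\<rho> < 1"
    and approx: "\<And>f B. f \<in> E \<Longrightarrow> B > 0 \<Longrightarrow> \<forall>x\<in>\<O>. av (f x) \<le> B \<Longrightarrow>
      \<exists>c N. (\<forall>i\<ge>N. c i = 0) \<and> (\<forall>i. av (c i) \<le> B) \<and>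
        (\<forall>x\<in>\<O>. av (f x - (\<Sum>i<N. c i * e i x)) \<le> \<rho> * B)"
  shows "orthonormal_basis av E e"
  unfolding orthonormal_basis_def
proof (intro conjI allI ballI)
  show "e n \<in> E" for n by (rule e)
next
  fix f assume f: "f \<in> E"
  define S where "S = sup_norm av f"
  have bd: "bdd_above ((\<lambda>x. av (f x)) ` \<O>)" using bdd[OF f] by (auto simp: bdd_above_def)
  have fS: "av (f x) \<le> S" if "x \<in> \<O>" for x
    unfolding S_def sup_norm_def by (rule cSUP_upper[OF that bd])
  have S0: "S \<ge> 0" using fS[OF O_0] order_trans[OF av_nonneg] by blast
  have extend: "(\<Sum>i<M. b i * e i x) = (\<Sum>i<N. b i * e i x)"
    if "\<forall>i\<ge>N. b i = 0" "N \<le> M" for b N M x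
    by (rule sum.mono_neutral_right) (use that in auto)
  \<comment> \<open>Stage \<open>k\<close> is a finitely supported coefficient sequence with error
    at most \<open>\<rho> ^ k * S\<close>. Starting from zero is what later bounds the limit
    coefficients by \<open>S\<close>.\<close>
  define P where "P = (\<lambda>k b. (k = 0 \<longrightarrow> b = (\<lambda>_. 0)) \<and> (\<exists>N. (\<forall>i\<ge>N. b i = 0) \<and>
      (\<forall>x\<in>\<O>. av (f x - (\<Sum>i<N. b i * e i x)) \<le> \<rho> ^ k * S)))"
  have P0: "\<exists>b. P 0 b"
    unfolding P_def using fS by (intro exI[of _ "\<lambda>_. 0"]) auto
  have PS: "\<exists>b'. P (Suc k) b' \<and> (\<forall>i. av (b' i - b i) \<le> \<rho> ^ k * S)" if Pk: "P k b" for k b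
  \<comment> \<open>The approximation hypothesis asks for a positive bound; for \<open>S = 0\<close>
    the old coefficients are already exact.\<close>
  proof (cases "S = 0")
    case True
    obtain N where N: "\<forall>i\<ge>N. b i = 0" "\<forall>x\<in>\<O>. av (f x - (\<Sum>i<N. b i * e i x)) \<le> \<rho> ^ k * S"
      using Pk by (auto simp: P_def)
    then show ?thesis using True by (intro exI[of _ b]) (auto simp: P_def)
  next
    case False
    obtain N where N: "\<forall>i\<ge>N. b i = 0" "\<forall>x\<in>\<O>. av (f x - (\<Sum>i<N. b i * e i x)) \<le> \<rho> ^ k * S"
      using Pk by (auto simp: P_def)
    have "\<rho> ^ k * S > 0" using \<rho> S0 False by simp
    from approx[OF closed[OF f] this N(2)] obtain c M where
      c: "\<forall>i\<ge>M. c i = 0" "\<forall>i. av (c i) \<le> \<rho> ^ k * S"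
      "\<forall>x\<in>\<O>. av (f x - (\<Sum>i<N. b i * e i x) - (\<Sum>i<M. c i * e i x)) \<le> \<rho> * (\<rho> ^ k * S)"
      by blast
    have "(\<Sum>i<max N M. (b i + c i) * e i x) = (\<Sum>i<N. b i * e i x) + (\<Sum>i<M. c i * e i x)" for x
      using extend[OF N(1), of "max N M" x] extend[OF c(1), of "max N M" x]
      by (simp add: distrib_right sum.distrib)
    then show ?thesis using N(1) c
      by (intro exI[of _ "\<lambda>i. b i + c i"])
        (auto simp: P_def mult.assoc diff_diff_eq intro!: exI[of _ "max N M"])
  qed
  obtain b where b: "\<And>k. P k (b k)" "\<And>k i. av (b (Suc k) i - b k i) \<le> \<rho> ^ k * S"
    using dependent_nat_choice[of P "\<lambda>k b b'. \<forall>i. av (b' i - b i) \<le> \<rho> ^ k * S", OF P0 PS] by blast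
  have b0: "b 0 = (\<lambda>_. 0)" using b(1)[of 0] by (simp add: P_def)
  have mono: "\<rho> ^ l * S \<le> \<rho> ^ k * S" if "k \<le> l" for k l
    using that \<rho> S0 by (intro mult_right_mono power_decreasing) auto
  have bl: "av (b l i - b k i) \<le> \<rho> ^ k * S" if "k \<le> l" for k l i
    using that
  proof (induction l rule: dec_induct)
    case base
    show ?case using \<rho> S0 by simp
  next
    case (step l)
    then show ?case using av_trans_le[of "b (Suc l) i" "b l i" "\<rho> ^ k * S" "b k i"]
        order_trans[OF b(2) mono] by auto
  qed
  have r: "(\<lambda>k. \<rho> ^ k * S) \<longlonglongrightarrow> 0"
    using \<rho> by (intro tendsto_mult_left_zero LIMSEQ_realpow_zero) auto
  have "\<exists>l. \<forall>k. av (l - b k i) \<le> \<rho> ^ k * S" for i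
    by (rule limit_with_rate[of "\<lambda>k. b k i", OF bl r]) auto
  then obtain c where c: "\<And>i k. av (c i - b k i) \<le> \<rho> ^ k * S" by metis
  have small: "\<exists>k. \<rho> ^ k * S < \<epsilon>" if "\<epsilon> > 0" for \<epsilon>
    using order_tendstoD(2)[OF r that] eventually_happens'[OF sequentially_bot] by metis
  have c_le: "av (c i) \<le> S" for i using c[of i 0] b0 by simp
  have conv0: "av_converges av c 0"
    unfolding av_converges_def
  proof (intro allI impI)
    fix \<epsilon> :: real assume "\<epsilon> > 0"
    then obtain k where k: "\<rho> ^ k * S < \<epsilon>" using small by blast
    obtain N where N: "\<forall>i\<ge>N. b k i = 0" using b(1)[of k] by (auto simp: P_def)
    then have "\<forall>n\<ge>N. av (c n - 0) < \<epsilon>" using c[of _ k] k by (metis le_less_trans)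
    then show "\<exists>N. \<forall>n\<ge>N. av (c n - 0) < \<epsilon>" by blast
  qed
  have exp: "\<exists>N0. \<forall>N\<ge>N0. \<forall>x\<in>\<O>. av (f x - (\<Sum>n<N. c n * e n x)) < \<epsilon>" if "\<epsilon> > 0" for \<epsilon>
  proof -
    obtain k where k: "\<rho> ^ k * S < \<epsilon>" using small[OF \<open>\<epsilon> > 0\<close>] by blast
    obtain N0 where N0: "\<forall>i\<ge>N0. b k i = 0"
      "\<forall>x\<in>\<O>. av (f x - (\<Sum>i<N0. b k i * e i x)) \<le> \<rho> ^ k * S"
      using b(1)[of k] by (auto simp: P_def)
    have "av (f x - (\<Sum>n<N. c n * e n x)) \<le> \<rho> ^ k * S" if "N \<ge> N0" "x \<in> \<O>" for N x
    proof -
      have "f x - (\<Sum>n<N. c n * e n x) =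
        (f x - (\<Sum>i<N0. b k i * e i x)) - (\<Sum>n<N. (c n - b k n) * e n x)"
        by (subst extend[OF N0(1) that(1), symmetric]) (simp add: left_diff_distrib sum_subtractf)
      moreover have "av (\<Sum>n<N. (c n - b k n) * e n x) \<le> \<rho> ^ k * S"
        using that(2) c le1 \<rho> S0 by (intro av_sum_le av_mult_le_left) (auto simp flip: mem_O)
      ultimately show ?thesis using av_diff_le[OF bspec[OF N0(2) that(2)]] by (simp only:)
    qed
    then show ?thesis using k by (meson le_less_trans)
  qed
  \<comment> \<open>One inequality is the coefficient bound from the iteration; the other is the
    ultrametric inequality applied to partial sums, as the \<open>e n\<close> take integral
    values.\<close>
  have "S = (SUP n. av (c n))"
  proof (rule antisym)
    show "(SUP n. av (c n)) \<le> S" by (rule cSUP_least) (auto simp: c_le)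
    have bc: "bdd_above (range (\<lambda>n. av (c n)))" using c_le by (auto simp: bdd_above_def)
    have C: "av (c n) \<le> (SUP n. av (c n))" for n by (rule cSUP_upper[OF _ bc]) simp
    have "av (f x) \<le> (SUP n. av (c n))" if xO: "x \<in> \<O>" for x
    proof (rule field_le_epsilon)
      fix \<epsilon> :: real assume "\<epsilon> > 0"
      from exp[OF this] obtain N where N: "av (f x - (\<Sum>n<N. c n * e n x)) < \<epsilon>"
        using xO by blast
      have C0: "0 \<le> (SUP n. av (c n))" using C[of 0] order_trans[OF av_nonneg] by blast
      have "av (\<Sum>n<N. c n * e n x) \<le> (SUP n. av (c n))"
        using C le1 xO C0 by (intro av_sum_le av_mult_le_left) (auto simp flip: mem_O)
      then have "av ((f x - (\<Sum>n<N. c n * e n x)) + (\<Sum>n<N. c n * e n x)) \<le> (SUP n. av (c n)) + \<epsilon>"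
        using N C0 \<open>\<epsilon> > 0\<close> by (intro av_add_le) auto
      then show "av (f x) \<le> (SUP n. av (c n)) + \<epsilon>" by simp
    qed
    then show "S \<le> (SUP n. av (c n))"
      unfolding S_def sup_norm_def by (intro cSUP_least) (auto intro: O_0)
  qed
  then show "\<exists>c. av_converges av c 0 \<and>
      (\<forall>\<epsilon>>0. \<exists>N0. \<forall>N\<ge>N0. \<forall>x\<in>\<O>. av (f x - (\<Sum>n<N. c n * e n x)) < \<epsilon>) \<and>
      sup_norm av f = (SUP n. av (c n))"
    using conv0 exp S_def by (intro exI[of _ c]) simp
qed

end

section \<open>Hyperdifferentials as a ring homomorphism to power series\<close>

lemma coeff_hyperdiff: "coeff (hyperdiff j p) n = of_nat ((n + j) choose j) * coeff p (n + j)"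
proof -
  have "coeff (hyperdiff j p) n =
      (\<Sum>m\<le>degree p. if m = n + j then of_nat (m choose j) * coeff p m else 0)"
    unfolding hyperdiff_def coeff_sum
  proof (rule sum.cong)
    fix m
    \<comment> \<open>For \<open>m < j\<close> the truncated exponent is 0, but the binomial
      coefficient vanishes.\<close>
    show "coeff (monom (of_nat (m choose j) * coeff p m) (m - j)) n =
        (if m = n + j then of_nat (m choose j) * coeff p m else 0)"
      by (cases "m < j") (auto simp: binomial_eq_0)
  qed simp
  also have "\<dots> = of_nat ((n + j) choose j) * coeff p (n + j)"
    by (auto simp: coeff_eq_0)
  finally show ?thesis .
qed

lemma hyperdiff_add: "hyperdiff j (p + q) = hyperdiff j p + hyperdiff j q"
  by (rule poly_eqI) (simp add: coeff_hyperdiff algebra_simps)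

lemma hyperdiff_0_left [simp]: "hyperdiff 0 p = p"
  by (rule poly_eqI) (simp add: coeff_hyperdiff)

lemma hyperdiff_0_right [simp]: "hyperdiff j 0 = 0"
  by (rule poly_eqI) (simp add: coeff_hyperdiff)

text \<open>Pascal's rule, read as the Leibniz rule for multiplication by \<open>T\<close>.\<close>

lemma hyperdiff_Suc_pCons:
  "hyperdiff (Suc j) (pCons a p) = hyperdiff j p + pCons 0 (hyperdiff (Suc j) p)"
proof (rule poly_eqI)
  fix n
  show "coeff (hyperdiff (Suc j) (pCons a p)) n =
      coeff (hyperdiff j p + pCons 0 (hyperdiff (Suc j) p)) n"
    by (cases n) (auto simp: coeff_hyperdiff algebra_simps)
qed

section \<open>The completion: density of polynomials and extension by continuity\<close>

locale pi_adic_field =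
  fixes \<pi> :: "'a::{finite,field} poly"
    and av :: "'k::field \<Rightarrow> real"
    and \<iota> :: "'a poly \<Rightarrow> 'k"
  assumes irred: "irreducible \<pi>"
    and completion: "pi_adic_completion \<pi> av \<iota>"

sublocale pi_adic_field \<subseteq> complete_nonarch_field av
  using completion by unfold_locales (auto simp: pi_adic_completion_def)

context pi_adic_field
begin

abbreviation "Q \<equiv> card (UNIV :: 'a set) ^ degree \<pi>"

abbreviation "\<rho> \<equiv> av (\<iota> \<pi>)"

abbreviation "D \<equiv> hyperdiff_ext av \<iota>"

abbreviation "F \<equiv> coeff_field Q :: 'k set"

lemma \<iota>_1 [simp]: "\<iota> 1 = 1"
  and \<iota>_add: "\<iota> (p + q) = \<iota> p + \<iota> q"
  and \<iota>_mult: "\<iota> (p * q) = \<iota> p * \<iota> q"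
  and inj_\<iota>: "inj \<iota>"
  and \<rho>: "0 < \<rho>" "\<rho> < 1"
  and av_\<iota>: "p \<noteq> 0 \<Longrightarrow> av (\<iota> p) = \<rho> ^ pi_val \<pi> p"
  and dense_fractions: "e > 0 \<Longrightarrow> \<exists>p q. q \<noteq> 0 \<and> av (x - \<iota> p / \<iota> q) < e"
  using completion by (auto simp: pi_adic_completion_def)

lemma \<rho>_tendsto: "(\<lambda>n. \<rho> ^ n) \<longlonglongrightarrow> 0"
  using \<rho> by (intro LIMSEQ_realpow_zero) auto

lemma ex_\<rho>_power_less: "e > 0 \<Longrightarrow> \<exists>n. \<rho> ^ n < e"
  using order_tendstoD(2)[OF \<rho>_tendsto] eventually_happens'[OF sequentially_bot] by metis

lemma \<iota>_0 [simp]: "\<iota> 0 = 0"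
  using \<iota>_add[of 0 0] by (simp only: add_0_right add_cancel_right_right)

lemma \<iota>_diff: "\<iota> (p - q) = \<iota> p - \<iota> q"
  using \<iota>_add[of "p - q" q] by simp

lemma \<iota>_eq_0_iff [simp]: "\<iota> p = 0 \<longleftrightarrow> p = 0"
  using inj_\<iota> \<iota>_0 by (metis injD)

lemma \<iota>_power: "\<iota> (p ^ n) = \<iota> p ^ n"
  by (induction n) (auto simp: \<iota>_mult)

lemma \<iota>_of_nat: "\<iota> (of_nat n) = of_nat n"
  by (induction n) (auto simp: \<iota>_add)

lemma \<iota>_pCons: "\<iota> (pCons a p) = \<iota> [:a:] + \<iota> [:0, 1:] * \<iota> p"
proof -
  have "pCons a p = [:a:] + [:0, 1:] * p" by simp
  then show ?thesis by (metis \<iota>_add \<iota>_mult)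
qed

lemma \<iota>_in_O [simp]: "\<iota> p \<in> \<O>"
  using av_\<iota>[of p] \<rho> by (cases "p = 0") (auto simp: mem_O power_le_one)

lemma degree_\<pi>_pos: "degree \<pi> > 0" and \<pi>_nz: "\<pi> \<noteq> 0"
  using irred by (auto simp: irreducible_def is_unit_iff_degree)

lemma Q_ge_2: "Q \<ge> 2"
proof -
  have "card {0 :: 'a, 1} \<le> card (UNIV :: 'a set)" by (intro card_mono) auto
  then have "2 \<le> card (UNIV :: 'a set)" by simp
  then show ?thesis using degree_\<pi>_pos
    by (metis One_nat_def Suc_leI order_trans power_increasing power_one_right one_le_numeral)
qed

lemma less_Q_power: "n < Q ^ n"
  using Q_ge_2 by (intro power_gt_expt) auto

lemma power_dvd_imp_av_le: "\<pi> ^ n dvd p \<Longrightarrow> av (\<iota> p) \<le> \<rho> ^ n"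
  using \<iota>_in_O by (auto simp: dvd_def \<iota>_mult \<iota>_power av_power mem_O intro!: av_mult_le_left)

lemma power_pi_val_dvd:
  assumes "p \<noteq> 0"
  shows "\<pi> ^ pi_val \<pi> p dvd p"
  unfolding pi_val_def
proof (rule GreatestI_nat[where b = "degree p" and k = 0])
  fix k assume "\<pi> ^ k dvd p"
  then have "k * degree \<pi> \<le> degree p"
    using dvd_imp_degree_le[OF _ assms] by (metis degree_power_eq \<pi>_nz)
  then show "k \<le> degree p" using degree_\<pi>_pos
    by (metis One_nat_def Suc_leI mult_le_mono2 mult.right_neutral order_trans)
qed simp

lemma av_le_imp_power_dvd:
  assumes "av (\<iota> p) \<le> \<rho> ^ n"
  shows "\<pi> ^ n dvd p"
proof (cases "p = 0")
  case False
  then have "n \<le> pi_val \<pi> p" using assms \<rho> by (simp add: av_\<iota> power_decreasing_iff)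
  then show ?thesis using power_pi_val_dvd[OF False] by (meson dvd_trans le_imp_power_dvd)
qed simp

lemma power_Q_minus_self: "(p :: 'a poly) * (p ^ (Q - 2) * p - 1) = p ^ Q - p"
proof -
  obtain k where "Q = Suc (Suc k)" using Q_ge_2 by (metis add_2_eq_Suc le_Suc_ex)
  then show ?thesis by (simp add: algebra_simps)
qed

text \<open>Fermat inverts \<open>q\<close> modulo \<open>\<pi>\<close>, and a geometric sum lifts the inverse to \<open>\<pi> ^ n\<close>.\<close>

lemma inverse_mod_power:
  assumes "\<not> \<pi> dvd q"
  obtains u where "\<pi> ^ n dvd 1 - q * u"
proof -
  define w where "w = 1 - q ^ (Q - 2) * q"
  have "prime_elem \<pi>" using irred field_poly_irreducible_imp_prime by blast
  moreover have "\<pi> dvd q * (q ^ (Q - 2) * q - 1)"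
    unfolding power_Q_minus_self by (rule poly_fermat[OF irred])
  ultimately have "\<pi> dvd q ^ (Q - 2) * q - 1" using assms prime_elem_dvd_mult_iff by blast
  then have "\<pi> dvd w" by (simp add: w_def dvd_diff_commute)
  then have "\<pi> ^ n dvd w ^ n" by (rule dvd_power_same)
  moreover have "1 - w ^ n = q * (q ^ (Q - 2) * (\<Sum>i<n. w ^ i))"
    by (subst one_diff_power_eq) (simp add: w_def algebra_simps)
  then have "w ^ n = 1 - q * (q ^ (Q - 2) * (\<Sum>i<n. w ^ i))"
    by (simp add: algebra_simps)
  ultimately show thesis using that by metis
qed

text \<open>Density of fractions in \<open>K\<close> is given; polynomials suffice for integral
  \<open>x\<close>. A fraction close to \<open>x\<close> is itself integral, so the power of
  \<open>\<pi>\<close> in its denominator cancels, and the remaining denominator is inverted modulo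
  \<open>\<pi> ^ n\<close> by a polynomial.\<close>

lemma dense_O:
  assumes "x \<in> \<O>"
  shows "\<exists>p. av (x - \<iota> p) \<le> \<rho> ^ n"
proof -
  obtain p q where q: "q \<noteq> 0" and pq: "av (x - \<iota> p / \<iota> q) < \<rho> ^ n"
    using dense_fractions[of "\<rho> ^ n" x] \<rho> by auto
  let ?k = "pi_val \<pi> q"
  have avq: "av (\<iota> q) = \<rho> ^ ?k" by (rule av_\<iota>[OF q])
  obtain q' where q'1: "q = \<pi> ^ ?k * q'" using power_pi_val_dvd[OF q] by (auto simp: dvd_def)
  have q'2: "\<not> \<pi> dvd q'"
  proof
    assume "\<pi> dvd q'"
    then have "\<pi> ^ Suc ?k dvd q" by (subst q'1) (simp add: mult.commute mult_dvd_mono)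
    then have "av (\<iota> q) \<le> \<rho> ^ Suc ?k" by (rule power_dvd_imp_av_le)
    then show False using avq \<rho> by simp
  qed
  have "av (\<iota> p / \<iota> q) \<le> 1"
    using av_diff_le[of x 1 "x - \<iota> p / \<iota> q"] assms pq power_le_one[of \<rho> n] \<rho>
    by (simp add: mem_O)
  then have "av (\<iota> p / \<iota> q) * av (\<iota> q) \<le> \<rho> ^ ?k" using avq \<rho> by simp
  then have "av (\<iota> p) \<le> \<rho> ^ ?k" using q by (simp flip: av_mult)
  then obtain p' where p': "p = \<pi> ^ ?k * p'" using av_le_imp_power_dvd by (auto simp: dvd_def)
  obtain u where u: "\<pi> ^ n dvd 1 - q' * u" using inverse_mod_power[OF q'2] .
  have [simp]: "q' \<noteq> 0" using q'2 by auto
  have "\<iota> p / \<iota> q = \<iota> p' / \<iota> q'"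
    using \<pi>_nz by (subst p', subst q'1) (simp add: \<iota>_mult \<iota>_power)
  then have "\<iota> p / \<iota> q - \<iota> (p' * u) = \<iota> p' / \<iota> q' * \<iota> (1 - q' * u)"
    by (simp add: \<iota>_mult \<iota>_diff field_simps)
  also have "av \<dots> \<le> \<rho> ^ n"
  proof (rule av_mult_le_right)
    show "av (\<iota> p' / \<iota> q') \<le> 1"
      using \<open>av (\<iota> p / \<iota> q) \<le> 1\<close> \<open>\<iota> p / \<iota> q = \<iota> p' / \<iota> q'\<close> by simp
  qed (use u power_dvd_imp_av_le in blast)
  finally have "av (x - \<iota> (p' * u)) \<le> \<rho> ^ n" using av_trans_le pq less_imp_le by blast
  then show ?thesis by blast
qed

lemma continuous_eqI:
  assumes "av_continuous_on av \<O> f" "av_continuous_on av \<O> g" "\<And>p. f (\<iota> p) = g (\<iota> p)" "x \<in> \<O>"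
  shows "f x = g x"
proof -
  have cont: "av_continuous_on av \<O> (\<lambda>x. f x - g x)" using assms by (intro av_continuous_on_diff)
  have "f x - g x = 0"
  proof (rule av_eq_0_if_small)
    fix e :: real assume "e > 0"
    then obtain \<delta> where \<delta>: "\<delta> > 0" "\<And>y. y \<in> \<O> \<Longrightarrow> av (y - x) < \<delta> \<Longrightarrow> av (f y - g y - (f x - g x)) < e"
      using av_continuous_onD[OF cont assms(4)] by blast
    obtain n where n: "\<rho> ^ n < \<delta>" using ex_\<rho>_power_less[OF \<delta>(1)] by blast
    obtain p where p: "av (x - \<iota> p) \<le> \<rho> ^ n" using dense_O[OF assms(4)] by blast
    have "av (f (\<iota> p) - g (\<iota> p) - (f x - g x)) < e"
      using p n by (intro \<delta>) (auto simp: av_diff_commute)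
    then show "av (f x - g x) \<le> e" by (simp add: assms(3) av_diff_commute)
  qed
  then show ?thesis by simp
qed

lemma continuous_in_OI:
  assumes cont: "av_continuous_on av \<O> f" and "\<And>p. f (\<iota> p) \<in> \<O>" and x: "x \<in> \<O>"
  shows "f x \<in> \<O>"
proof -
  obtain \<delta> where \<delta>: "\<delta> > 0" "\<And>y. y \<in> \<O> \<Longrightarrow> av (y - x) < \<delta> \<Longrightarrow> av (f y - f x) < 1"
    using av_continuous_onD[OF cont x, of 1] by auto
  obtain n where n: "\<rho> ^ n < \<delta>" using ex_\<rho>_power_less[OF \<delta>(1)] by blast
  obtain p where p: "av (x - \<iota> p) \<le> \<rho> ^ n" using dense_O[OF x] by blast
  have "av (f (\<iota> p) - f x) < 1" using p n by (intro \<delta>) (auto simp: av_diff_commute)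
  then show ?thesis using av_diff_le[of "f (\<iota> p)" 1 "f (\<iota> p) - f x"] assms(2) by (simp add: mem_O)
qed

text \<open>By additivity the bound on \<open>G\<close> is a Lipschitz condition, so the values at
  polynomial approximations of \<open>x\<close> converge with rate \<open>C * \<rho> ^ k\<close>.
  The same rate is a modulus of continuity of the limit.\<close>

lemma continuous_extension:
  assumes G_add: "\<And>p q. G (p + q) = G p + G q"
    and G_le: "\<And>p. av (G p) \<le> C * av (\<iota> p)" and C: "C > 0"
  shows "\<exists>g. av_continuous_on av \<O> g \<and> (\<forall>p. g (\<iota> p) = G p)"
proof -
  have G_diff: "G (p - q) = G p - G q" for p q using G_add[of "p - q" q] by simp
  have G_close: "av (G p - G q) \<le> C * \<rho> ^ k"
    if "av (x - \<iota> p) \<le> \<rho> ^ k" "av (x - \<iota> q) \<le> \<rho> ^ k" for x p q k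
  proof -
    have "av (\<iota> (p - q)) \<le> \<rho> ^ k"
      using av_diff_le[OF that(2) that(1)] by (simp add: \<iota>_diff)
    then show ?thesis using G_le[of "p - q"] C by (simp add: G_diff) (meson mult_le_cancel_left_pos order_trans)
  qed
  have "\<exists>P. \<forall>n. av (x - \<iota> (P n)) \<le> \<rho> ^ n" if "x \<in> \<O>" for x
    using dense_O[OF that] by metis
  then obtain P where P: "\<And>x n. x \<in> \<O> \<Longrightarrow> av (x - \<iota> (P x n)) \<le> \<rho> ^ n" by metis
  have "\<exists>l. \<forall>k. av (l - G (P x k)) \<le> C * \<rho> ^ k" if "x \<in> \<O>" for x
  proof -
    have "av (G (P x l) - G (P x k)) \<le> C * \<rho> ^ k" if "k \<le> l" for k l
    proof (rule G_close)
      have "\<rho> ^ l \<le> \<rho> ^ k" using that \<rho> by (intro power_decreasing) auto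
      then show "av (x - \<iota> (P x l)) \<le> \<rho> ^ k" using P[OF \<open>x \<in> \<O>\<close>] order_trans by blast
    qed (rule P[OF \<open>x \<in> \<O>\<close>])
    moreover have "(\<lambda>k. C * \<rho> ^ k) \<longlonglongrightarrow> 0" using \<rho>_tendsto by (rule tendsto_mult_right_zero)
    ultimately show ?thesis by (rule limit_with_rate[of "\<lambda>k. G (P x k)"]) auto
  qed
  then obtain g where g: "\<And>x k. x \<in> \<O> \<Longrightarrow> av (g x - G (P x k)) \<le> C * \<rho> ^ k" by metis
  have gG: "av (g x - G q) \<le> C * \<rho> ^ k" if "x \<in> \<O>" "av (x - \<iota> q) \<le> \<rho> ^ k" for x q k
    using av_trans_le[OF g[OF that(1)] G_close[OF P[OF that(1)] that(2)]] .
  have small: "\<exists>k. C * \<rho> ^ k < e" if "e > 0" for e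
    using ex_\<rho>_power_less[of "e / C"] that C by (auto simp: field_simps)
  have "g (\<iota> p) = G p" for p
  proof -
    have "g (\<iota> p) - G p = 0"
    proof (rule av_eq_0_if_small)
      fix e :: real assume "e > 0"
      then obtain k where "C * \<rho> ^ k < e" using small by blast
      then show "av (g (\<iota> p) - G p) \<le> e" using gG[of "\<iota> p" p k] \<rho> by simp
    qed
    then show ?thesis by simp
  qed
  moreover have "av_continuous_on av \<O> g"
  proof (rule av_continuous_onI)
    fix x e assume x: "x \<in> \<O>" and "(e :: real) > 0"
    then obtain k where k: "C * \<rho> ^ k < e" using small by blast
    show "\<exists>\<delta>>0. \<forall>y\<in>\<O>. av (y - x) < \<delta> \<longrightarrow> av (g y - g x) \<le> e"
    proof (intro exI[of _ "\<rho> ^ k"] conjI ballI impI)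
      fix y assume y: "y \<in> \<O>" "av (y - x) < \<rho> ^ k"
      have "av (y - \<iota> (P x k)) \<le> \<rho> ^ k" using av_trans_le[of y x] y P[OF x] less_imp_le by blast
      from gG[OF y(1) this] gG[OF x P[OF x]] have "av (g y - g x) \<le> C * \<rho> ^ k"
        using av_trans_le av_diff_commute by metis
      then show "av (g y - g x) \<le> e" using k by simp
    qed (use \<rho> in simp)
  qed
  ultimately show ?thesis by blast
qed

section \<open>The generating series of the hyperderivatives and its weighted bounds\<close>

definition \<Phi> :: "'a poly \<Rightarrow> 'k fps" where
  "\<Phi> p = Abs_fps (\<lambda>j. \<iota> (hyperdiff j p))"

lemma \<Phi>_0: "\<Phi> 0 = 0"
  by (rule fps_ext) (simp add: \<Phi>_def)

lemma \<Phi>_add: "\<Phi> (p + q) = \<Phi> p + \<Phi> q"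
  by (rule fps_ext) (simp add: \<Phi>_def hyperdiff_add \<iota>_add)

text \<open>Horner's scheme at \<open>T + X\<close>: the series \<open>\<Phi> p\<close> is the
  Taylor expansion of \<open>p(T + X)\<close> in powers of \<open>X\<close>. Multiplicativity of
  \<open>\<Phi>\<close> is therefore the Leibniz rule for all orders at once.\<close>

lemma \<Phi>_pCons: "\<Phi> (pCons a p) = fps_const (\<iota> [:a:]) + (fps_const (\<iota> [:0, 1:]) + fps_X) * \<Phi> p"
proof (rule fps_ext)
  fix n
  show "\<Phi> (pCons a p) $ n = (fps_const (\<iota> [:a:]) + (fps_const (\<iota> [:0, 1:]) + fps_X) * \<Phi> p) $ n"
  proof (cases n)
    case 0
    then show ?thesis using \<iota>_pCons[of a p] by (simp add: \<Phi>_def distrib_right)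
  next
    case (Suc j)
    then show ?thesis using \<iota>_pCons[of 0 "hyperdiff (Suc j) p"]
      by (simp add: \<Phi>_def distrib_right hyperdiff_Suc_pCons \<iota>_add)
  qed
qed

lemma \<Phi>_const: "\<Phi> [:a:] = fps_const (\<iota> [:a:])"
  by (simp add: \<Phi>_pCons \<Phi>_0)

lemma \<Phi>_smult: "\<Phi> (smult a p) = fps_const (\<iota> [:a:]) * \<Phi> p"
proof (induction p)
  case (pCons b p)
  have "fps_const (\<iota> [:a * b:]) = fps_const (\<iota> [:a:]) * fps_const (\<iota> [:b:])"
    using \<iota>_mult[of "[:a:]" "[:b:]"] by (simp add: mult.commute)
  then show ?case using pCons by (simp add: \<Phi>_pCons distrib_left mult.left_commute del: fps_const_mult)
qed (simp add: \<Phi>_0)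

lemma \<Phi>_mult: "\<Phi> (p * q) = \<Phi> p * \<Phi> q"
proof (induction p)
  case (pCons a p)
  then show ?case by (simp add: \<Phi>_pCons \<Phi>_add \<Phi>_smult algebra_simps)
qed (simp add: \<Phi>_0)

lemma \<Phi>_power: "\<Phi> (p ^ n) = \<Phi> p ^ n"
proof (induction n)
  case 0
  show ?case using \<Phi>_const[of 1] by (simp add: one_pCons flip: one_pCons)
qed (simp add: \<Phi>_mult)

text \<open>The bound \<open>\<bar>f\<^sub>j\<bar> \<rho> ^ j \<le> B\<close> on coefficients is multiplicative, and \<open>\<Phi> \<pi>\<close> satisfies it with
  \<open>B = \<rho>\<close>. Hence \<open>\<D>\<^sub>j\<close> is \<open>\<pi>\<close>-adically Lipschitz.\<close>

lemma weighted_bound_mult: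
  assumes "\<And>j. av (f $ j) * \<rho> ^ j \<le> B" "\<And>j. av (g $ j) * \<rho> ^ j \<le> C"
  shows "av ((f * g) $ j) * \<rho> ^ j \<le> B * C"
proof -
  have "0 \<le> av (f $ 0) * \<rho> ^ 0" "0 \<le> av (g $ 0) * \<rho> ^ 0" by simp_all
  then have BC: "0 \<le> B" "0 \<le> C" using assms order_trans by blast+
  have "av (f $ i * g $ (j - i)) \<le> B * C / \<rho> ^ j" if "i \<le> j" for i
  proof -
    have "av (f $ i) * \<rho> ^ i * (av (g $ (j - i)) * \<rho> ^ (j - i)) \<le> B * C"
      using assms BC \<rho> by (intro mult_mono) auto
    moreover have "\<rho> ^ j = \<rho> ^ i * \<rho> ^ (j - i)" using that by (simp flip: power_add)
    ultimately show ?thesis using \<rho> by (simp add: av_mult field_simps)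
  qed
  then have "av ((f * g) $ j) \<le> B * C / \<rho> ^ j"
    unfolding fps_mult_nth using BC \<rho> by (intro av_sum_le) auto
  then show ?thesis using \<rho> by (simp add: field_simps)
qed

lemma weighted_bound_power:
  assumes "\<And>j. av (f $ j) * \<rho> ^ j \<le> B"
  shows "av ((f ^ n) $ j) * \<rho> ^ j \<le> B ^ n"
proof (induction n arbitrary: j)
  case 0
  show ?case by simp
next
  case (Suc n)
  then show ?case using weighted_bound_mult[OF assms Suc.IH] by simp
qed

lemma av_hyperdiff_le: "av (\<iota> (hyperdiff j p)) * \<rho> ^ j \<le> av (\<iota> p)"
proof (cases "p = 0")
  case False
  have 1: "av (\<Phi> q $ i) \<le> 1" for q i using \<iota>_in_O by (simp add: \<Phi>_def flip: mem_O)
  \<comment> \<open>At \<open>i = 0\<close> the coefficient is \<open>\<iota> \<pi>\<close> itself;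
    for larger \<open>i\<close> it is integral and the weight already contributes a factor
    \<open>\<rho>\<close>.\<close>
  have "av (\<Phi> \<pi> $ i) * \<rho> ^ i \<le> \<rho>" for i
  proof (cases i)
    case (Suc i')
    have "av (\<Phi> \<pi> $ i) * \<rho> ^ i \<le> 1 * \<rho> ^ 1"
      using 1 \<rho> Suc by (intro mult_mono power_decreasing) auto
    then show ?thesis by simp
  qed (simp add: \<Phi>_def)
  note 2 = weighted_bound_power[OF this]
  obtain q where q: "p = \<pi> ^ pi_val \<pi> p * q" using power_pi_val_dvd[OF False] by (auto simp: dvd_def)
  have 3: "av (\<Phi> q $ i) * \<rho> ^ i \<le> 1" for i
    using 1[of q i] \<rho> by (simp add: mult_le_one power_le_one)
  have "av ((\<Phi> \<pi> ^ pi_val \<pi> p * \<Phi> q) $ j) * \<rho> ^ j \<le> \<rho> ^ pi_val \<pi> p * 1"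
    by (rule weighted_bound_mult[OF 2 3])
  also have "\<Phi> \<pi> ^ pi_val \<pi> p * \<Phi> q = \<Phi> p" by (subst q) (simp add: \<Phi>_mult \<Phi>_power)
  finally show ?thesis using av_\<iota>[OF False] by (simp add: \<Phi>_def)
qed simp

text \<open>Existence of a continuous extension makes the choice in \<open>hyperdiff_ext\<close>
  meaningful. The choice fixes nothing outside \<open>\<O>\<close>, so facts about \<open>D\<close>
  are confined to integral arguments.\<close>

lemma D_continuous: "av_continuous_on av \<O> (D j)"
  and D_\<iota>: "D j (\<iota> p) = \<iota> (hyperdiff j p)"
proof -
  have "av (\<iota> (hyperdiff j p)) \<le> 1 / \<rho> ^ j * av (\<iota> p)" for p
    using av_hyperdiff_le[of j p] \<rho> by (simp add: pos_le_divide_eq)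
  then have "\<exists>g. av_continuous_on av \<O> g \<and> (\<forall>p. g (\<iota> p) = \<iota> (hyperdiff j p))"
    using \<rho> by (intro continuous_extension[where C = "1 / \<rho> ^ j"]) (auto simp: hyperdiff_add \<iota>_add)
  then have "av_continuous_on av \<O> (D j) \<and> (\<forall>p. D j (\<iota> p) = \<iota> (hyperdiff j p))"
    unfolding hyperdiff_ext_def by (rule someI_ex)
  then show "av_continuous_on av \<O> (D j)" "D j (\<iota> p) = \<iota> (hyperdiff j p)"
    by blast+
qed

end

section \<open>The uniformizer and the digit expansion\<close>

context pi_adic_field
begin

lemma continuous_contraction:
  assumes f: "av_continuous_on av \<O> f"
    and h: "\<And>x. x \<in> \<O> \<Longrightarrow> h x \<in> \<O>" "\<And>x y. x \<in> \<O> \<Longrightarrow> y \<in> \<O> \<Longrightarrow> av (h y - h x) \<le> av (y - x)"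
  shows "av_continuous_on av \<O> (\<lambda>x. f (h x))"
proof (rule av_continuous_onI)
  fix x e assume x: "x \<in> \<O>" and e: "(e :: real) > 0"
  obtain \<delta> where \<delta>: "\<delta> > 0" "\<And>y. y \<in> \<O> \<Longrightarrow> av (y - h x) < \<delta> \<Longrightarrow> av (f y - f (h x)) < e"
    using av_continuous_onD[OF f h(1)[OF x] e] by blast
  then have "\<forall>y\<in>\<O>. av (y - x) < \<delta> \<longrightarrow> av (f (h y) - f (h x)) \<le> e"
    using h x by (meson le_less_trans less_imp_le)
  then show "\<exists>\<delta>>0. \<forall>y\<in>\<O>. av (y - x) < \<delta> \<longrightarrow> av (f (h y) - f (h x)) \<le> e"
    using \<delta>(1) by blast
qed

lemma continuous_add_arg: "av_continuous_on av \<O> f \<Longrightarrow> c \<in> \<O> \<Longrightarrow> av_continuous_on av \<O> (\<lambda>x. f (x + c))"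
  by (rule continuous_contraction) auto

lemma continuous_mult_arg:
  assumes "av_continuous_on av \<O> f" "c \<in> \<O>"
  shows "av_continuous_on av \<O> (\<lambda>x. f (x * c))"
proof (rule continuous_contraction[OF assms(1)])
  fix x y
  have "av ((y - x) * c) \<le> av (y - x)" using assms(2) by (intro av_mult_le_left) (auto simp: mem_O)
  then show "av (y * c - x * c) \<le> av (y - x)" by (simp add: algebra_simps)
qed (use assms in auto)

lemma av_continuous_on_add:
  assumes "av_continuous_on av \<O> f" "av_continuous_on av \<O> g"
  shows "av_continuous_on av \<O> (\<lambda>x. f x + g x)"
  using av_continuous_on_diff[OF assms(1) av_continuous_on_diff[OF av_continuous_on_const[of 0] assms(2)]]
  by simp

definition \<Psi> :: "'k \<Rightarrow> 'k fps" where
  "\<Psi> x = Abs_fps (\<lambda>j. D j x)"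

lemma \<Psi>_nth [simp]: "\<Psi> x $ j = D j x"
  by (simp add: \<Psi>_def)

lemma \<Psi>_\<iota>: "\<Psi> (\<iota> p) = \<Phi> p"
  by (rule fps_ext) (simp add: \<Phi>_def D_\<iota>)

lemma D_in_O: "x \<in> \<O> \<Longrightarrow> D j x \<in> \<O>"
  by (rule continuous_in_OI[OF D_continuous]) (simp_all add: D_\<iota>)

lemma D_0: "x \<in> \<O> \<Longrightarrow> D 0 x = x"
  by (rule continuous_eqI[OF D_continuous, of "\<lambda>x. x"])
    (auto simp: D_\<iota> av_continuous_on_def)

text \<open>Density is applied to one variable at a time, with the other one fixed, so continuity in
  two variables never enters. The Leibniz rule is extended in the same way.\<close>

lemma D_add:
  assumes "x \<in> \<O>" "y \<in> \<O>"
  shows "D j (x + y) = D j x + D j y"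
proof -
  have cont: "av_continuous_on av \<O> (\<lambda>x. D j (x + c))" "av_continuous_on av \<O> (\<lambda>x. D j x + D j c)"
    if "c \<in> \<O>" for c
    by (intro continuous_add_arg D_continuous that)
      (intro av_continuous_on_add av_continuous_on_const D_continuous)
  have "D j (z + \<iota> p) = D j z + D j (\<iota> p)" if "z \<in> \<O>" for z p
    by (rule continuous_eqI[OF cont(1) cont(2) _ that])
      (simp_all add: D_\<iota> hyperdiff_add \<iota>_add flip: \<iota>_add)
  from this[OF assms(1)] have "D j (\<iota> p + x) = D j (\<iota> p) + D j x" for p
    by (simp add: add.commute)
  then have "D j (y + x) = D j y + D j x"
    by (rule continuous_eqI[OF cont(1)[OF assms(1)] cont(2)[OF assms(1)] _ assms(2)])
  then show ?thesis by (simp add: add.commute)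
qed

lemma D_mult:
  assumes "x \<in> \<O>" "y \<in> \<O>"
  shows "D j (x * y) = (\<Sum>i=0..j. D i x * D (j - i) y)"
proof -
  have base: "D j (\<iota> q * \<iota> p) = (\<Sum>i=0..j. D i (\<iota> q) * D (j - i) (\<iota> p))" for p q
    using arg_cong[OF \<Phi>_mult[of q p], of "\<lambda>f. f $ j"]
    by (simp add: fps_mult_nth D_\<iota> \<Phi>_def flip: \<iota>_mult)
  have cont: "av_continuous_on av \<O> (\<lambda>x. D j (x * c))"
    "av_continuous_on av \<O> (\<lambda>x. \<Sum>i=0..j. D i x * D (j - i) c)"
    "av_continuous_on av \<O> (\<lambda>x. \<Sum>i=0..j. D i c * D (j - i) x)" if "c \<in> \<O>" for c
    by (intro continuous_mult_arg D_continuous that)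
      (intro av_continuous_on_sum av_continuous_on_mult av_continuous_on_const D_continuous)+
  have "D j (z * \<iota> p) = (\<Sum>i=0..j. D i z * D (j - i) (\<iota> p))" if "z \<in> \<O>" for z p
    by (rule continuous_eqI[OF cont(1) cont(2) base that]) simp_all
  from this[OF assms(1)] have "D j (\<iota> p * x) = (\<Sum>i=0..j. D i x * D (j - i) (\<iota> p))" for p
    by (simp add: mult.commute)
  then have "D j (y * x) = (\<Sum>i=0..j. D i x * D (j - i) y)"
    by (rule continuous_eqI[OF cont(1)[OF assms(1)] cont(3)[OF assms(1)] _ assms(2)])
  then show ?thesis by (simp add: mult.commute)
qed

lemma \<Psi>_add: "x \<in> \<O> \<Longrightarrow> y \<in> \<O> \<Longrightarrow> \<Psi> (x + y) = \<Psi> x + \<Psi> y"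
  by (rule fps_ext) (simp add: D_add)

lemma \<Psi>_mult: "x \<in> \<O> \<Longrightarrow> y \<in> \<O> \<Longrightarrow> \<Psi> (x * y) = \<Psi> x * \<Psi> y"
  by (rule fps_ext) (simp add: D_mult fps_mult_nth)

lemma \<Psi>_1: "\<Psi> 1 = 1"
  using \<Psi>_\<iota>[of 1] \<Phi>_power[of 0 0] by simp

lemma \<Psi>_power: "x \<in> \<O> \<Longrightarrow> \<Psi> (x ^ n) = \<Psi> x ^ n"
  by (induction n) (auto simp: \<Psi>_1 \<Psi>_mult O_power)

section \<open>Frobenius powers and the coefficient field\<close>

lemma CHAR_K: "CHAR('k) = CHAR('a)"
proof (rule CHAR_eqI)
  have "\<iota> (of_nat CHAR('a)) = 0"
    by (metis \<iota>_0 of_nat_CHAR semiring_char_poly)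
  then show "of_nat CHAR('a) = (0 :: 'k)" by (simp only: \<iota>_of_nat)
  fix n assume "of_nat n = (0 :: 'k)"
  then have "\<iota> (of_nat n) = 0" by (simp only: \<iota>_of_nat)
  then have "of_nat n = (0 :: 'a poly)" by (simp only: \<iota>_eq_0_iff)
  then show "CHAR('a) dvd n" by (metis of_nat_eq_0_iff_char_dvd semiring_char_poly)
qed

lemma Q_power_CHAR: "\<exists>m. Q ^ n = CHAR('k) ^ m"
  using finite_field_card_CHAR_power[where 'a = 'a] by (metis CHAR_K power_mult)

lemma frobenius_add: "(x + y :: 'k) ^ (Q ^ n) = x ^ (Q ^ n) + y ^ (Q ^ n)"
  using Q_power_CHAR[of n] prime_CHAR_finite[where 'a = 'a] CHAR_K freshmans_dream'[where 'a = 'k] by metis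

lemma frobenius_add_fps: "(f + g :: 'k fps) ^ (Q ^ n) = f ^ (Q ^ n) + g ^ (Q ^ n)"
  using Q_power_CHAR[of n] prime_CHAR_finite[where 'a = 'a] CHAR_K freshmans_dream'[where 'a = "'k fps"]
  by (metis semiring_char_fps)

lemma frobenius_diff: "(x - y :: 'k) ^ (Q ^ n) = x ^ (Q ^ n) - y ^ (Q ^ n)"
  using frobenius_add[of "x - y" y n] by simp

lemma F_power: "c \<in> F \<Longrightarrow> c ^ (Q ^ n) = c"
  by (induction n) (auto simp: coeff_field_def power_mult)

lemma F_add: "c \<in> F \<Longrightarrow> c' \<in> F \<Longrightarrow> c + c' \<in> F"
  and F_diff: "c \<in> F \<Longrightarrow> c' \<in> F \<Longrightarrow> c - c' \<in> F"
  using frobenius_add[of c c' 1] frobenius_diff[of c c' 1] by (auto simp: coeff_field_def)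

lemma F_mult: "c \<in> F \<Longrightarrow> c' \<in> F \<Longrightarrow> c * c' \<in> F"
  by (auto simp: coeff_field_def power_mult_distrib)

lemma F_0: "0 \<in> F"
  using Q_ge_2 by (simp add: coeff_field_def finite_UNIV_card_ge_0)

text \<open>The real number \<open>av c\<close> solves \<open>a ^ Q = a\<close> with
  \<open>Q \<ge> 2\<close>. Hence an element of \<open>F\<close> in the maximal ideal is zero, and
  distinct elements of \<open>F\<close> have distinct residues.\<close>

lemma F_av_cases:
  assumes "c \<in> F"
  shows "c = 0 \<or> av c = 1"
proof (rule ccontr)
  assume *: "\<not> (c = 0 \<or> av c = 1)"
  have eq: "av c ^ Q = av c ^ 1" using assms by (simp add: coeff_field_def flip: av_power)
  have "av c > 0" using * av_nonneg[of c] av_eq_0_iff[of c] by linarith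
  then show False
    using eq * Q_ge_2 power_inject_exp[of "av c" Q 1] power_inject_exp'[of "av c" Q 1]
    by (metis linorder_neqE_linordered_idom numeral_le_one_iff semiring_norm(69))
qed

lemma F_subset_O: "c \<in> F \<Longrightarrow> c \<in> \<O>"
  using F_av_cases[of c] by (auto simp: mem_O)

lemma F_eq_0: "c \<in> F \<Longrightarrow> av c < 1 \<Longrightarrow> c = 0"
  using F_av_cases[of c] by auto

lemma F_nonzero_power: "c \<in> F \<Longrightarrow> c \<noteq> 0 \<Longrightarrow> c ^ (Q - 1) = 1"
proof -
  assume c: "c \<in> F" "c \<noteq> 0"
  obtain k where k: "Q = Suc k" using Q_ge_2 by (metis Suc_le_D numeral_2_eq_2)
  then show "c ^ (Q - 1) = 1" using c by (simp add: coeff_field_def)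
qed

lemma finite_F: "finite F"
proof -
  let ?p = "monom 1 Q - monom 1 1 :: 'k poly"
  have "coeff ?p Q = 1" using Q_ge_2 by simp
  then have "?p \<noteq> 0" by (metis coeff_0 zero_neq_one)
  then have "finite {x. poly ?p x = 0}" by (rule poly_roots_finite)
  then show ?thesis by (simp add: coeff_field_def poly_monom)
qed

text \<open>For a constant the difference in Fermat's congruence is again constant, and a constant
  divisible by \<open>\<pi>\<close> is zero.\<close>

lemma \<iota>_const_in_F: "\<iota> [:a:] \<in> F"
proof -
  have "\<pi> dvd [:a:] ^ Q - [:a:]" by (rule poly_fermat[OF irred])
  moreover have "[:a:] ^ Q - [:a:] = [:a ^ Q - a:]" by (simp add: poly_const_pow)
  ultimately have "[:a:] ^ Q - [:a:] = 0"
    using degree_\<pi>_pos dvd_imp_degree_le[of \<pi> "[:a ^ Q - a:]"] by (metis degree_pCons_0 not_le)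
  then have "\<iota> ([:a:] ^ Q) = \<iota> [:a:]" by (metis right_minus_eq)
  then show ?thesis by (simp add: coeff_field_def \<iota>_power)
qed

text \<open>Raising \<open>c = c ^ Q ^ n\<close> to a high Frobenius power pushes the nonconstant part of \<open>\<Psi> c\<close>
  beyond any given degree.\<close>

lemma D_F:
  assumes c: "c \<in> F" and j: "j > 0"
  shows "D j c = 0"
proof -
  define g where "g = fps_shift 1 (\<Psi> c)"
  have "\<Psi> c = fps_const (D 0 c) + fps_X * g"
    using fps_shift_times_fps_X'[of "\<Psi> c - fps_const (D 0 c)"]
    by (intro fps_ext) (simp add: g_def)
  then have "\<Psi> c ^ (Q ^ j) = fps_const (D 0 c ^ (Q ^ j)) + fps_X ^ (Q ^ j) * g ^ (Q ^ j)"
    by (simp only: frobenius_add_fps power_mult_distrib fps_const_power)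
  moreover have "\<Psi> c ^ (Q ^ j) = \<Psi> c"
    using \<Psi>_power[OF F_subset_O[OF c]] F_power[OF c] by metis
  ultimately have "\<Psi> c $ j = (fps_const (D 0 c ^ (Q ^ j)) + fps_X ^ (Q ^ j) * g ^ (Q ^ j)) $ j"
    by (simp only:)
  also have "\<dots> = 0" using j less_Q_power[of j] by (simp add: fps_X_power_mult_nth)
  finally show ?thesis by simp
qed

lemma \<Psi>_F: "c \<in> F \<Longrightarrow> \<Psi> c = fps_const c"
  by (rule fps_ext) (auto simp: D_F D_0 F_subset_O)

lemma D_F_mult: "c \<in> F \<Longrightarrow> x \<in> \<O> \<Longrightarrow> D j (c * x) = c * D j x"
  using \<Psi>_mult[of c x] by (metis F_subset_O \<Psi>_F \<Psi>_nth fps_mult_left_const_nth)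

text \<open>The Teichmueller limit of \<open>T ^ (Q ^ k)\<close>. Additivity of Frobenius turns
  consecutive differences into \<open>(T ^ Q - T) ^ (Q ^ k)\<close>, which are small by Fermat; the
  rate at \<open>k = 0\<close> is the distance from \<open>T\<close>.\<close>

lemma teichmueller_T: "\<exists>\<theta>\<in>F. av (\<iota> [:0, 1:] - \<theta>) \<le> \<rho>"
proof -
  define T where "T = \<iota> [:0, 1:]"
  have T: "av (T ^ Q - T) \<le> \<rho>"
    using power_dvd_imp_av_le[of 1 "[:0, 1:] ^ Q - [:0, 1:]"] poly_fermat[OF irred]
    by (simp add: T_def \<iota>_diff \<iota>_power)
  define s where "s = (\<lambda>k. T ^ (Q ^ k))"
  have step: "av (s (Suc l) - s l) \<le> \<rho> ^ Suc l" for l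
  proof -
    have "s (Suc l) - s l = (T ^ Q - T) ^ (Q ^ l)"
      by (simp add: s_def frobenius_diff power_mult)
    also have "av \<dots> \<le> \<rho> ^ (Q ^ l)" using T by (simp add: av_power power_mono)
    also have "\<dots> \<le> \<rho> ^ Suc l" using less_Q_power[of l] \<rho> by (intro power_decreasing) auto
    finally show ?thesis .
  qed
  have "av (s l - s k) \<le> \<rho> ^ Suc k" if "k \<le> l" for k l
    using that
  proof (induction l rule: dec_induct)
    case (step l)
    have "\<rho> ^ Suc l \<le> \<rho> ^ Suc k" using step \<rho> by (intro power_decreasing) auto
    then show ?case using av_trans_le[of "s (Suc l)" "s l"] step.IH \<open>av (s (Suc l) - s l) \<le> \<rho> ^ Suc l\<close>
      by (meson order_trans)
  qed (use \<rho> in simp)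
  moreover have "(\<lambda>k. \<rho> ^ Suc k) \<longlonglongrightarrow> 0" using \<rho>_tendsto by (rule LIMSEQ_Suc)
  ultimately have "\<exists>\<theta>. \<forall>k. av (\<theta> - s k) \<le> \<rho> ^ Suc k"
    by (rule limit_with_rate[of s "\<lambda>k. \<rho> ^ Suc k"]) auto
  then obtain \<theta> where \<theta>: "\<And>k. av (\<theta> - s k) \<le> \<rho> ^ Suc k" by blast
  have sO: "s k \<in> \<O>" for k by (auto simp: s_def T_def)
  have "\<theta> - s 0 \<in> \<O>" using \<theta>[of 0] \<rho> by (simp add: mem_O)
  then have \<theta>O: "\<theta> \<in> \<O>" using O_add[OF _ sO[of 0]] by fastforce
  have "\<theta> ^ Q - \<theta> = 0"
  proof (rule av_eq_0_if_small)
    fix e :: real assume "e > 0"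
    then obtain k where k: "\<rho> ^ k < e" using ex_\<rho>_power_less by blast
    have le: "\<rho> ^ Suc (Suc k) \<le> \<rho> ^ Suc k" using \<rho> by (intro power_decreasing) auto
    have "s k ^ Q = s (Suc k)" by (simp only: s_def power_Suc2 power_mult)
    then have "av (\<theta> ^ Q - s (Suc k)) \<le> \<rho> ^ Suc k"
      using av_diff_power_le[OF \<theta>[of k] \<theta>O sO, of Q] by simp
    moreover have "av (s (Suc k) - \<theta>) \<le> \<rho> ^ Suc k"
      using \<theta>[of "Suc k"] le by (simp add: av_diff_commute)
    ultimately have "av (\<theta> ^ Q - \<theta>) \<le> \<rho> ^ Suc k" by (rule av_trans_le)
    also have "\<dots> \<le> \<rho> ^ k" using \<rho> by (intro power_decreasing) auto
    finally show "av (\<theta> ^ Q - \<theta>) \<le> e" using k by simp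
  qed
  then have "\<theta> \<in> F" by (simp add: coeff_field_def)
  moreover have "av (\<iota> [:0, 1:] - \<theta>) \<le> \<rho>" using \<theta>[of 0] by (simp add: s_def T_def av_diff_commute)
  ultimately show ?thesis by blast
qed

section \<open>Expansions in powers of \<open>t\<close> and their hyperderivatives\<close>

definition \<theta> :: 'k where
  "\<theta> = (SOME c. c \<in> F \<and> av (\<iota> [:0, 1:] - c) \<le> \<rho>)"

definition t :: 'k where
  "t = \<iota> [:0, 1:] - \<theta>"

lemma \<theta>_in_F: "\<theta> \<in> F" and av_t_le: "av t \<le> \<rho>"
proof -
  have "\<theta> \<in> F \<and> av (\<iota> [:0, 1:] - \<theta>) \<le> \<rho>"
    unfolding \<theta>_def by (rule someI_ex) (use teichmueller_T in blast)
  then show "\<theta> \<in> F" "av t \<le> \<rho>" by (auto simp: t_def)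
qed

text \<open>The induction builds the value of \<open>p\<close> at \<open>\<theta>\<close>, which
  agrees with \<open>p\<close> modulo \<open>t = T - \<theta>\<close>. The bound is
  \<open>av t\<close> and not \<open>\<rho>\<close>, because equality of the two is deduced from
  it.\<close>

lemma residue_poly: "\<exists>c\<in>F. av (\<iota> p - c) \<le> av t"
proof (induction p)
  case 0
  show ?case using F_0 by (intro bexI[of _ 0]) auto
next
  case (pCons a p)
  then obtain c where c: "c \<in> F" "av (\<iota> p - c) \<le> av t" by blast
  have "\<iota> (pCons a p) - (\<iota> [:a:] + \<theta> * c) = \<iota> [:0, 1:] * (\<iota> p - c) + t * c"
    by (subst \<iota>_pCons) (simp add: t_def algebra_simps)
  moreover have "av (\<iota> [:0, 1:] * (\<iota> p - c)) \<le> av t"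
    using c(2) \<iota>_in_O by (intro av_mult_le_right) (auto simp flip: mem_O)
  moreover have "av (t * c) \<le> av t"
    using F_subset_O[OF c(1)] by (intro av_mult_le_left) (auto simp: mem_O)
  ultimately have "av (\<iota> (pCons a p) - (\<iota> [:a:] + \<theta> * c)) \<le> av t" using av_add_le by simp
  then show ?case using c(1) by (blast intro: F_add F_mult \<iota>_const_in_F \<theta>_in_F)
qed

text \<open>The reverse inequality holds because \<open>\<pi>(\<theta>)\<close> is a coefficient of absolute value below 1,
  hence zero.\<close>

lemma av_t: "av t = \<rho>"
proof -
  obtain c where c: "c \<in> F" "av (\<iota> \<pi> - c) \<le> av t" using residue_poly by blast
  have "av (\<iota> \<pi> - c) \<le> \<rho>" using c(2) av_t_le by simp
  then have "av c \<le> \<rho>" using av_diff_le[of "\<iota> \<pi>" \<rho> "\<iota> \<pi> - c"] by simp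
  then have "c = 0" using F_eq_0[OF c(1)] \<rho> by simp
  then show ?thesis using c(2) av_t_le by simp
qed

lemma t_in_O: "t \<in> \<O>"
  using av_t \<rho> by (simp add: mem_O)

text \<open>Since \<open>t\<close> has the same absolute value as \<open>\<pi>\<close>, the quotient
  \<open>(x - c) / t\<close> is still integral.\<close>

lemma first_digit:
  assumes "x \<in> \<O>"
  shows "\<exists>c\<in>F. \<exists>y\<in>\<O>. x = c + t * y"
proof -
  obtain p where p: "av (x - \<iota> p) \<le> \<rho> ^ 1" using dense_O[OF assms] by blast
  obtain c where c: "c \<in> F" "av (\<iota> p - c) \<le> \<rho>" using residue_poly av_t by metis
  have xc: "av (x - c) \<le> \<rho>" using av_trans_le[of x "\<iota> p" \<rho> c] p c by simp
  have t: "t \<noteq> 0" using av_t \<rho> by auto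
  have "av ((x - c) / t) * av t \<le> 1 * \<rho>" using xc t by (simp flip: av_mult)
  then have "(x - c) / t \<in> \<O>" using av_t \<rho> by (simp add: mem_O)
  then show ?thesis using c(1) t by (intro bexI[of _ c] bexI[of _ "(x - c) / t"]) auto
qed

lemma digits:
  assumes "x \<in> \<O>"
  shows "\<exists>c y. (\<forall>m. c m \<in> F) \<and> y \<in> \<O> \<and> x = (\<Sum>m<n. c m * t ^ m) + t ^ n * y"
proof (induction n)
  case 0
  show ?case using assms F_0 by (intro exI[of _ "\<lambda>_. 0"]) auto
next
  case (Suc n)
  then obtain c y where c: "\<forall>m. c m \<in> F" and y: "y \<in> \<O>" and x: "x = (\<Sum>m<n. c m * t ^ m) + t ^ n * y"
    by blast
  obtain d z where d: "d \<in> F" "z \<in> \<O>" "y = d + t * z" using first_digit[OF y] by blast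
  have "x = (\<Sum>m<Suc n. (c(n := d)) m * t ^ m) + t ^ Suc n * z"
    by (simp add: x d(3) algebra_simps)
  then show ?case using c d by (intro exI[of _ "c(n := d)"] exI[of _ z]) auto
qed

lemma \<Psi>_t: "\<Psi> t = fps_const t + fps_X"
proof -
  have "\<Psi> (\<iota> [:0, 1:]) = \<Psi> (t + \<theta>)" by (simp add: t_def)
  also have "\<dots> = \<Psi> t + fps_const \<theta>"
    using t_in_O \<theta>_in_F by (simp add: \<Psi>_add \<Psi>_F F_subset_O)
  finally have "\<Psi> t = \<Psi> (\<iota> [:0, 1:]) - fps_const \<theta>" by simp
  also have "\<Psi> (\<iota> [:0, 1:]) = fps_const (\<iota> [:0, 1:]) + fps_X"
    using \<Phi>_pCons[of 0 "[:1:]"] \<Phi>_power[of 0 0] by (simp add: \<Psi>_\<iota> one_pCons)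
  also have "\<dots> - fps_const \<theta> = fps_const (\<iota> [:0, 1:] - \<theta>) + fps_X"
    by (simp flip: fps_const_sub)
  finally show ?thesis by (simp add: t_def)
qed

text \<open>As \<open>\<Psi> (t ^ m)\<close> is the power \<open>(t + X) ^ m\<close>, the value is
  the binomial coefficient of \<open>m\<close> over \<open>j\<close> times
  \<open>t ^ (m - j)\<close>. Only its reduction modulo the maximal ideal matters: the identity
  matrix.\<close>

lemma D_t_power:
  "D m (t ^ m) = 1" "j > m \<Longrightarrow> D j (t ^ m) = 0" "j < m \<Longrightarrow> av (D j (t ^ m)) \<le> \<rho>"
proof (induction m arbitrary: j)
  case 0
  {
    case 1
    show ?case by (simp add: D_0)
  next
    case 2
    then show ?case using D_F[of 1 j] by (simp add: coeff_field_def)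
  next
    case 3
    then show ?case by simp
  }
next
  case (Suc m)
  have rec: "D (Suc i) (t ^ Suc m) = t * D (Suc i) (t ^ m) + D i (t ^ m)" for i
  proof -
    have "\<Psi> (t ^ Suc m) = (fps_const t + fps_X) * \<Psi> (t ^ m)"
      using t_in_O by (simp add: \<Psi>_mult \<Psi>_t O_power)
    from arg_cong[OF this, of "\<lambda>f. f $ Suc i"] show ?thesis by (simp add: distrib_right)
  qed
  {
    case 1
    show ?case using Suc.IH unfolding rec by simp
  next
    case 2
    then obtain i where "j = Suc i" "m < i" by (cases j) auto
    then show ?case using Suc.IH(2)[of i] Suc.IH(2)[of "Suc i"] by (simp add: rec del: power_Suc)
  next
    case 3
    have t1: "av (t * D j (t ^ m)) \<le> \<rho>" for j
      using av_t D_in_O[OF O_power[OF t_in_O]] by (intro av_mult_le_left) (auto simp flip: mem_O)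
    show ?case
    proof (cases j)
      case 0
      have "av (t ^ Suc m) \<le> \<rho> * 1"
        using av_t O_power[OF t_in_O, of m] by (simp add: av_mult mem_O mult_left_le)
      then show ?thesis using 0 O_power[OF t_in_O, of "Suc m"] by (simp add: D_0 del: power_Suc)
    next
      case (Suc i)
      then have "av (D i (t ^ m)) \<le> \<rho>" using 3 Suc.IH(3) by simp
      then show ?thesis unfolding Suc rec by (intro av_add_le t1)
    qed
  }
qed

lemma D_sum: "(\<And>i. i \<in> A \<Longrightarrow> f i \<in> \<O>) \<Longrightarrow> D j (sum f A) = (\<Sum>i\<in>A. D j (f i))"
proof (induction A rule: infinite_finite_induct)
  case (insert x B)
  then show ?case by (auto simp: D_add O_sum)
qed (use D_F_mult[OF F_0 O_0] in auto)

lemma digits_D: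
  assumes "x \<in> \<O>"
  shows "\<exists>c y. (\<forall>m. c m \<in> F) \<and> y \<in> \<O> \<and> x = (\<Sum>m<n. c m * t ^ m) + t ^ n * y \<and>
    (\<forall>j<n. av (D j x - c j) \<le> \<rho>)"
proof -
  obtain c y where c: "\<forall>m. c m \<in> F" and y: "y \<in> \<O>" and x: "x = (\<Sum>m<n. c m * t ^ m) + t ^ n * y"
    using digits[OF assms] by blast
  have "av (D j x - c j) \<le> \<rho>" if j: "j < n" for j
  proof -
    have O: "t ^ m \<in> \<O>" "c m \<in> \<O>" for m using t_in_O c F_subset_O by auto
    have "D j x = (\<Sum>m<n. c m * D j (t ^ m)) + D j (t ^ n * y)"
      using c O y by (simp add: x D_add D_sum O_sum O_mult D_F_mult)
    also have "(\<Sum>m<n. c m * D j (t ^ m)) = c j + (\<Sum>m\<in>{..<n} - {j}. c m * D j (t ^ m))"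
      using j by (subst sum.remove[of _ j]) (auto simp: D_t_power)
    finally have "D j x - c j = (\<Sum>m\<in>{..<n} - {j}. c m * D j (t ^ m)) + D j (t ^ n * y)" by simp
    moreover have "av (\<Sum>m\<in>{..<n} - {j}. c m * D j (t ^ m)) \<le> \<rho>"
    proof (rule av_sum_le)
      fix m assume "m \<in> {..<n} - {j}"
      then have "av (D j (t ^ m)) \<le> \<rho>" using D_t_power(2)[of m j] D_t_power(3)[of j m] \<rho>
        by (cases "j < m") auto
      then show "av (c m * D j (t ^ m)) \<le> \<rho>" using O by (intro av_mult_le_right) (auto simp flip: mem_O)
    qed (use \<rho> in simp)
    \<comment> \<open>Each Leibniz term of the tail has a factor \<open>D i (t ^ n)\<close> with
      \<open>i \<le> j < n\<close>, which is small.\<close>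
    moreover have "av (D j (t ^ n * y)) \<le> \<rho>"
    proof -
      have "av (D i (t ^ n) * D (j - i) y) \<le> \<rho>" if "i \<le> j" for i
        using that j D_t_power(3)[of i n] D_in_O[OF y] by (intro av_mult_le_left) (auto simp flip: mem_O)
      then show ?thesis using O y \<rho> by (subst D_mult) (auto intro!: av_sum_le)
    qed
    ultimately show ?thesis using av_add_le by simp
  qed
  then show ?thesis using c y x by blast
qed

end

section \<open>The two orthonormal bases\<close>

text \<open>Because \<open>i < Q ^ i\<close>, the range \<open>j \<le> i\<close> in
  \<open>digit_ext\<close> reaches every nonzero digit, and zero digits contribute 1. The two ranges
  are compared inside a common larger one.\<close>

lemma digit_ext_eq_prod:
  fixes e :: "nat \<Rightarrow> 'k \<Rightarrow> 'k::comm_ring_1"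
  assumes "Q \<ge> 2" "i < Q ^ n"
  shows "digit_ext Q e i x = (\<Prod>j<n. e j x ^ ((i div Q ^ j) mod Q))"
proof -
  let ?g = "\<lambda>j. e j x ^ ((i div Q ^ j) mod Q)"
  have one: "?g j = 1" if "i < Q ^ m" "m \<le> j" for j m
  proof -
    have "Q ^ m \<le> Q ^ j" using assms(1) that(2) by (intro power_increasing) auto
    then show ?thesis using that(1) by simp
  qed
  have "i < Q ^ i" using assms(1) by (intro power_gt_expt) auto
  then have "(\<Prod>j\<le>i. ?g j) = (\<Prod>j<max n (Suc i). ?g j)"
    by (intro prod.mono_neutral_left ballI one[of i]) auto
  also have "\<dots> = (\<Prod>j<n. ?g j)"
    using assms(2) by (intro prod.mono_neutral_right ballI one[of n]) auto
  finally show ?thesis by (simp add: digit_ext_def)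
qed

lemma digit_ext_add_digit:
  fixes e :: "nat \<Rightarrow> 'k \<Rightarrow> 'k::comm_ring_1"
  assumes Q: "Q \<ge> 2" and i: "i < Q ^ n" and k: "k < Q"
  shows "digit_ext Q e (i + k * Q ^ n) x = digit_ext Q e i x * e n x ^ k"
proof -
  have "i + k * Q ^ n < Q ^ n + k * Q ^ n" using i by simp
  also have "\<dots> = Suc k * Q ^ n" by simp
  also have "\<dots> \<le> Q * Q ^ n" using k by (intro mult_right_mono) auto
  finally have "i + k * Q ^ n < Q ^ Suc n" by simp
  moreover have "((i + k * Q ^ n) div Q ^ j) mod Q = (i div Q ^ j) mod Q" if "j < n" for j
  proof -
    \<comment> \<open>This exhibits \<open>k * Q ^ n\<close> as a multiple of
      \<open>Q * Q ^ j\<close>, so the lower digits are unaffected.\<close>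
    obtain m where "n = Suc (j + m)" using \<open>j < n\<close> less_imp_Suc_add by blast
    then have eq: "i + k * Q ^ n = i + (k * Q ^ m * Q) * Q ^ j" by (simp add: power_add mult_ac)
    show ?thesis unfolding eq using Q by simp
  qed
  moreover have "((i + k * Q ^ n) div Q ^ n) mod Q = k" using i k Q by simp
  ultimately show ?thesis
    using digit_ext_eq_prod[OF Q i, of e x] digit_ext_eq_prod[OF Q, of "i + k * Q ^ n" "Suc n" e x]
    by simp
qed

context nonarch_field
begin

text \<open>Expanding the product chooses an exponent below \<open>Q\<close> in each of
  \<open>n\<close> positions; these choices are the digit strings of the numbers below
  \<open>Q ^ n\<close>.\<close>

lemma digit_ext_span:
  assumes Q: "Q \<ge> 2" and b: "\<And>j k. b j k \<in> \<O>"
  shows "\<exists>c. (\<forall>i. c i \<in> \<O>) \<and>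
    (\<forall>x. (\<Prod>j<n. \<Sum>k<Q. b j k * e j x ^ k) = (\<Sum>i<Q ^ n. c i * digit_ext Q e i x))"
proof (induction n)
  case 0
  show ?case using Q by (intro exI[of _ "\<lambda>_. 1"]) (simp add: digit_ext_def)
next
  case (Suc n)
  then obtain c where c: "\<And>i. c i \<in> \<O>"
    "\<And>x. (\<Prod>j<n. \<Sum>k<Q. b j k * e j x ^ k) = (\<Sum>i<Q ^ n. c i * digit_ext Q e i x)"
    by blast
  \<comment> \<open>Division by \<open>Q ^ n\<close> separates the new leading digit from the index
    of the earlier product.\<close>
  define c' where "c' = (\<lambda>l. c (l mod Q ^ n) * b n (l div Q ^ n))"
  have "(\<Prod>j<Suc n. \<Sum>k<Q. b j k * e j x ^ k) = (\<Sum>l<Q ^ Suc n. c' l * digit_ext Q e l x)" for x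
  proof -
    have "(\<Sum>l<Q ^ Suc n. c' l * digit_ext Q e l x) =
        (\<Sum>k<Q. \<Sum>l\<in>{k * Q ^ n..<k * Q ^ n + Q ^ n}. c' l * digit_ext Q e l x)"
      by (subst sum.nat_group) (simp add: mult.commute)
    also have "\<dots> = (\<Sum>k<Q. \<Sum>i<Q ^ n. c' (i + k * Q ^ n) * digit_ext Q e (i + k * Q ^ n) x)"
    proof (rule sum.cong)
      fix k
      show "(\<Sum>l\<in>{k * Q ^ n..<k * Q ^ n + Q ^ n}. c' l * digit_ext Q e l x) =
          (\<Sum>i<Q ^ n. c' (i + k * Q ^ n) * digit_ext Q e (i + k * Q ^ n) x)"
        using sum.shift_bounds_nat_ivl[of "\<lambda>l. c' l * digit_ext Q e l x" 0 "k * Q ^ n" "Q ^ n"]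
        by (simp add: atLeast0LessThan add.commute)
    qed simp
    also have "\<dots> = (\<Sum>k<Q. \<Sum>i<Q ^ n. (c i * digit_ext Q e i x) * (b n k * e n x ^ k))"
      using Q by (intro sum.cong refl) (simp add: c'_def digit_ext_add_digit mult_ac)
    also have "\<dots> = (\<Sum>i<Q ^ n. c i * digit_ext Q e i x) * (\<Sum>k<Q. b n k * e n x ^ k)"
      by (subst sum.swap) (simp add: sum_product)
    finally show ?thesis by (simp add: c(2))
  qed
  moreover have "c' l \<in> \<O>" for l using c b by (auto simp: c'_def)
  ultimately show ?case by blast
qed

end

context pi_adic_field
begin

section \<open>Residue classes, uniform continuity and boundedness\<close>

lemma finite_digit_functions: "finite ({..<n :: nat} \<rightarrow>\<^sub>E F)"
  by (intro finite_PiE finite_F) auto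

text \<open>Restricting the digits to \<open>{..<n}\<close> places them in a finite set of strings
  that represent the classes modulo \<open>t ^ n\<close>, over which maxima and sums can be
  taken.\<close>

lemma digits_PiE:
  assumes "x \<in> \<O>"
  obtains a where "a \<in> {..<n} \<rightarrow>\<^sub>E F" "av (x - (\<Sum>m<n. a m * t ^ m)) \<le> \<rho> ^ n"
    "\<And>j. j < n \<Longrightarrow> av (D j x - a j) \<le> \<rho>"
proof -
  obtain c y where c: "\<forall>m. c m \<in> F" "y \<in> \<O>" "x = (\<Sum>m<n. c m * t ^ m) + t ^ n * y"
    "\<forall>j<n. av (D j x - c j) \<le> \<rho>"
    using digits_D[OF assms] by blast
  have "av (t ^ n * y) \<le> \<rho> ^ n"
    using c(2) by (intro av_mult_le_left) (auto simp: mem_O av_power av_t)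
  then show thesis
    using c by (intro that[of "restrict c {..<n}"]) auto
qed

lemma digit_sum_in_O: "a \<in> {..<n} \<rightarrow>\<^sub>E F \<Longrightarrow> (\<Sum>m<n. a m * t ^ m) \<in> \<O>"
  using t_in_O F_subset_O by (intro O_sum O_mult O_power) auto

text \<open>If uniform continuity failed, it would fail on a nested sequence of
  balls, against continuity at their common point.\<close>

lemma uniform_continuity:
  assumes f: "av_continuous_on av \<O> f" and e: "e > 0"
  shows "\<exists>n. \<forall>x\<in>\<O>. \<forall>y\<in>\<O>. av (x - y) \<le> \<rho> ^ n \<longrightarrow> av (f x - f y) \<le> e"
proof (rule ccontr)
  assume contra: "\<not> ?thesis"
  \<comment> \<open>The ball of radius \<open>\<rho> ^ n\<close> around \<open>z\<close> is bad if
    no modulus serves the fixed \<open>e\<close> on it; for \<open>n = 0\<close> and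
    \<open>z = 0\<close> the ball is all of \<open>\<O>\<close>.\<close>
  define bad where "bad = (\<lambda>z n. \<forall>m. \<exists>x\<in>\<O>. \<exists>y\<in>\<O>. av (x - z) \<le> \<rho> ^ n \<and> av (y - z) \<le> \<rho> ^ n \<and>
      av (x - y) \<le> \<rho> ^ m \<and> \<not> av (f x - f y) \<le> e)"
  have "\<exists>z. z \<in> \<O> \<and> bad z 0"
    using contra unfolding bad_def by (intro exI[of _ 0]) (auto simp flip: mem_O)
  moreover have "\<exists>z'. (z' \<in> \<O> \<and> bad z' (Suc n)) \<and> av (z' - z) \<le> \<rho> ^ n" if z: "z \<in> \<O> \<and> bad z n" for z n
  proof (rule ccontr)
    assume none: "\<not> ?thesis"
    have "\<exists>m. \<forall>x\<in>\<O>. \<forall>y\<in>\<O>. av (x - (z + c * t ^ n)) \<le> \<rho> ^ Suc n \<longrightarrow>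
        av (y - (z + c * t ^ n)) \<le> \<rho> ^ Suc n \<longrightarrow> av (x - y) \<le> \<rho> ^ m \<longrightarrow> av (f x - f y) \<le> e"
      if "c \<in> F" for c
    proof -
      have "c * t ^ n \<in> \<O>" using t_in_O F_subset_O[OF that] by auto
      moreover have "av (c * t ^ n) \<le> \<rho> ^ n"
        using F_subset_O[OF that] by (intro av_mult_le_right) (auto simp: mem_O av_power av_t)
      ultimately have "\<not> bad (z + c * t ^ n) (Suc n)" using none z by auto
      then show ?thesis unfolding bad_def by blast
    qed
    then obtain m where m: "\<And>c x y. c \<in> F \<Longrightarrow> x \<in> \<O> \<Longrightarrow> y \<in> \<O> \<Longrightarrow>
        av (x - (z + c * t ^ n)) \<le> \<rho> ^ Suc n \<Longrightarrow> av (y - (z + c * t ^ n)) \<le> \<rho> ^ Suc n \<Longrightarrow>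
        av (x - y) \<le> \<rho> ^ m c \<Longrightarrow> av (f x - f y) \<le> e"
      by metis
    \<comment> \<open>Finiteness of \<open>F\<close> gives one modulus for all sub-balls; including
      \<open>Suc n\<close> forces \<open>x\<close> and \<open>y\<close> into the same
      sub-ball.\<close>
    define M where "M = Max (insert (Suc n) (m ` F))"
    have M: "Suc n \<le> M" "\<And>c. c \<in> F \<Longrightarrow> m c \<le> M"
      using finite_F by (auto simp: M_def)
    obtain x y where xy: "x \<in> \<O>" "y \<in> \<O>" "av (x - z) \<le> \<rho> ^ n" "av (x - y) \<le> \<rho> ^ M"
      "\<not> av (f x - f y) \<le> e"
      using z unfolding bad_def by blast
    have pow: "\<rho> ^ M \<le> \<rho> ^ k" if "k \<le> M" for k using that \<rho> by (intro power_decreasing) auto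
    have tn: "t \<noteq> 0" using av_t \<rho> by auto
    have "av ((x - z) / t ^ n) * av (t ^ n) \<le> 1 * \<rho> ^ n" using xy(3) tn by (simp flip: av_mult)
    then have "(x - z) / t ^ n \<in> \<O>" using \<rho> by (simp add: mem_O av_power av_t)
    then obtain c w where c: "c \<in> F" "w \<in> \<O>" "(x - z) / t ^ n = c + t * w"
      using first_digit by blast
    have "x - (z + c * t ^ n) = t ^ Suc n * w"
      using c(3) tn by (simp add: field_simps)
    then have x: "av (x - (z + c * t ^ n)) \<le> \<rho> ^ Suc n"
      using c(2) by (simp only:) (intro av_mult_le_left, auto simp: mem_O av_power av_mult av_t)
    moreover have "av (y - x) \<le> \<rho> ^ Suc n"
      using xy(4) pow[OF M(1)] av_diff_commute[of x y] by simp
    ultimately have "av (y - (z + c * t ^ n)) \<le> \<rho> ^ Suc n" using av_trans_le by blast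
    then show False using m[OF c(1) xy(1,2) x] xy(4,5) pow[OF M(2)[OF c(1)]] by simp
  qed
  ultimately obtain z where z: "\<And>n. z n \<in> \<O>" "\<And>n. bad (z n) n"
    "\<And>n. av (z (Suc n) - z n) \<le> \<rho> ^ n"
    using dependent_nat_choice[of "\<lambda>n z. z \<in> \<O> \<and> bad z n" "\<lambda>n z z'. av (z' - z) \<le> \<rho> ^ n"] by blast
  have "av (z l - z k) \<le> \<rho> ^ k" if "k \<le> l" for k l
    using that
  proof (induction l rule: dec_induct)
    case (step l)
    have "\<rho> ^ l \<le> \<rho> ^ k" using step \<rho> by (intro power_decreasing) auto
    then show ?case using av_trans_le[of "z (Suc l)" "z l"] step.IH z(3) by (meson order_trans)
  qed (use \<rho> in simp)
  then have "\<exists>l. \<forall>k. av (l - z k) \<le> \<rho> ^ k"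
    by (rule limit_with_rate[of z, OF _ \<rho>_tendsto]) auto
  then obtain l where l: "\<And>k. av (l - z k) \<le> \<rho> ^ k" by blast
  have "l - z 0 \<in> \<O>" using l[of 0] by (simp add: mem_O)
  then have "l \<in> \<O>" using O_add[OF _ z(1)[of 0]] by fastforce
  then obtain \<delta> where \<delta>: "\<delta> > 0" "\<And>y. y \<in> \<O> \<Longrightarrow> av (y - l) < \<delta> \<Longrightarrow> av (f y - f l) < e"
    using av_continuous_onD[OF f _ e] by blast
  obtain n where n: "\<rho> ^ n < \<delta>" using ex_\<rho>_power_less[OF \<delta>(1)] by blast
  obtain x y where xy: "x \<in> \<O>" "y \<in> \<O>" "av (x - z n) \<le> \<rho> ^ n" "av (y - z n) \<le> \<rho> ^ n"
    "\<not> av (f x - f y) \<le> e"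
    using z(2)[of n] unfolding bad_def by blast
  have "av (x - l) \<le> \<rho> ^ n" "av (y - l) \<le> \<rho> ^ n"
    using av_trans_le[OF xy(3)] av_trans_le[OF xy(4)] l[of n] by (simp_all add: av_diff_commute)
  then have "av (f x - f l) < e" "av (f y - f l) < e" using \<delta>(2) xy(1,2) n by auto
  then have "av ((f x - f l) - (f y - f l)) < e" by (rule av_diff_less)
  then show False using xy(5) by simp
qed

lemma continuous_bounded:
  assumes f: "av_continuous_on av \<O> f"
  shows "\<exists>B. \<forall>x\<in>\<O>. av (f x) \<le> B"
proof -
  obtain n where n: "\<And>x y. x \<in> \<O> \<Longrightarrow> y \<in> \<O> \<Longrightarrow> av (x - y) \<le> \<rho> ^ n \<Longrightarrow> av (f x - f y) \<le> 1"
    using uniform_continuity[OF f, of 1] by auto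
  define s where "s = (\<lambda>a. \<Sum>m<n. a m * t ^ m)"
  \<comment> \<open>The inserted 1 covers the oscillation of \<open>f\<close> within a residue
    class.\<close>
  define B where "B = Max (insert 1 ((\<lambda>a. av (f (s a))) ` ({..<n} \<rightarrow>\<^sub>E F)))"
  have B: "1 \<le> B" "\<And>a. a \<in> {..<n} \<rightarrow>\<^sub>E F \<Longrightarrow> av (f (s a)) \<le> B"
    using finite_digit_functions by (auto simp: B_def)
  have "av (f x) \<le> B" if x: "x \<in> \<O>" for x
  proof -
    obtain a where a: "a \<in> {..<n} \<rightarrow>\<^sub>E F" "av (x - s a) \<le> \<rho> ^ n"
      using digits_PiE[OF x] unfolding s_def by blast
    have "av (f x - f (s a)) \<le> B"
      using n[OF x _ a(2)] digit_sum_in_O[OF a(1)] B(1) by (simp add: s_def)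
    then have "av ((f x - f (s a)) + f (s a)) \<le> B" using B(2)[OF a(1)] by (rule av_add_le)
    then show ?thesis by simp
  qed
  then show ?thesis by blast
qed

lemma hyperdiff_orthonormal_basis: "orthonormal_basis av (cont_lin_space av Q) D"
proof (rule orthonormal_basisI[where \<rho> = \<rho>])
  show "D n \<in> cont_lin_space av Q" for n
    by (simp add: cont_lin_space_def D_continuous D_add D_F_mult)
  show "\<exists>B. \<forall>x\<in>\<O>. av (f x) \<le> B" if "f \<in> cont_lin_space av Q" for f
    using that by (intro continuous_bounded) (simp add: cont_lin_space_def)
  show "(\<lambda>x. f x - (\<Sum>i<N. c i * D i x)) \<in> cont_lin_space av Q" if "f \<in> cont_lin_space av Q" for f c N
    using that unfolding cont_lin_space_def
    by (auto intro!: av_continuous_on_diff av_continuous_on_sum av_continuous_on_mult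
        av_continuous_on_const D_continuous
        simp: D_add D_F_mult distrib_left sum.distrib right_diff_distrib sum_distrib_left mult.left_commute)
next
  fix f B assume "f \<in> cont_lin_space av Q" and B: "(B :: real) > 0" and f_le: "\<forall>x\<in>\<O>. av (f x) \<le> B"
  then have f: "av_continuous_on av \<O> f"
    and f_add: "\<And>x y. x \<in> \<O> \<Longrightarrow> y \<in> \<O> \<Longrightarrow> f (x + y) = f x + f y"
    and f_mult: "\<And>c x. c \<in> F \<Longrightarrow> x \<in> \<O> \<Longrightarrow> f (c * x) = c * f x"
    by (auto simp: cont_lin_space_def)
  have f0: "f 0 = 0" using f_add[OF O_0 O_0] by (simp only: add_0_right add_cancel_right_right)
  have f_sum: "f (sum g A) = (\<Sum>i\<in>A. f (g i))" if "\<And>i. i \<in> A \<Longrightarrow> g i \<in> \<O>" for g and A :: "nat set"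
    using that by (induction A rule: infinite_finite_induct) (auto simp: f0 f_add O_sum)
  obtain M where M: "\<And>x y. x \<in> \<O> \<Longrightarrow> y \<in> \<O> \<Longrightarrow> av (x - y) \<le> \<rho> ^ M \<Longrightarrow> av (f x - f y) \<le> \<rho> * B"
    using uniform_continuity[OF f, of "\<rho> * B"] B \<rho> by auto
  \<comment> \<open>Linearity gives \<open>f\<close> at a digit sum as the sum of
    \<open>a n * f (t ^ n)\<close>, and \<open>D n x\<close> agrees with the digit
    \<open>a n\<close> up to \<open>\<rho>\<close>. So the values at powers of \<open>t\<close> are
    the coefficients.\<close>
  define c where "c = (\<lambda>n. if n < M then f (t ^ n) else 0)"
  have "av (f x - (\<Sum>n<M. c n * D n x)) \<le> \<rho> * B" if x: "x \<in> \<O>" for x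
  proof -
    obtain a where a: "a \<in> {..<M} \<rightarrow>\<^sub>E F" "av (x - (\<Sum>m<M. a m * t ^ m)) \<le> \<rho> ^ M"
      "\<And>j. j < M \<Longrightarrow> av (D j x - a j) \<le> \<rho>"
      using digits_PiE[OF x] by blast
    have aF: "a m \<in> F" "a m \<in> \<O>" if "m < M" for m using a(1) that F_subset_O by auto
    have "f (\<Sum>m<M. a m * t ^ m) = (\<Sum>m<M. a m * f (t ^ m))"
      using t_in_O aF by (subst f_sum) (auto intro!: sum.cong f_mult)
    then have "f x - (\<Sum>n<M. c n * D n x) =
        (f x - f (\<Sum>m<M. a m * t ^ m)) - (\<Sum>n<M. (D n x - a n) * f (t ^ n))"
      by (simp add: c_def right_diff_distrib sum_subtractf mult.commute[of _ "f _"])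
    moreover have "av (f x - f (\<Sum>m<M. a m * t ^ m)) \<le> \<rho> * B"
      using M[OF x digit_sum_in_O[OF a(1)] a(2)] .
    moreover have "av (\<Sum>n<M. (D n x - a n) * f (t ^ n)) \<le> \<rho> * B"
      using a(3) f_le t_in_O \<rho> B by (intro av_sum_le av_mult_le) auto
    ultimately show ?thesis using av_diff_le by (simp only:)
  qed
  moreover have "av (c i) \<le> B" for i using f_le t_in_O B by (auto simp: c_def)
  ultimately show "\<exists>c N. (\<forall>i\<ge>N. c i = 0) \<and> (\<forall>i. av (c i) \<le> B) \<and>
      (\<forall>x\<in>\<O>. av (f x - (\<Sum>i<N. c i * D i x)) \<le> \<rho> * B)"
    by (intro exI[of _ c] exI[of _ M]) (auto simp: c_def)
qed (auto intro: D_in_O \<rho>)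

text \<open>Fermat's indicator \<open>1 - (X - a) ^ (Q - 1)\<close> of a digit \<open>a\<close>.\<close>

lemma digit_indicator_expand:
  "1 - (y - a :: 'k) ^ (Q - 1) =
    (\<Sum>k<Q. (of_bool (k = 0) - of_nat ((Q - 1) choose k) * (- a) ^ (Q - 1 - k)) * y ^ k)"
proof -
  obtain q where q: "Q = Suc q" using Q_ge_2 by (metis Suc_le_D numeral_2_eq_2)
  have "(y + - a) ^ q = (\<Sum>k\<le>q. of_nat (q choose k) * y ^ k * (- a) ^ (q - k))"
    by (rule binomial_ring)
  moreover have "(\<Sum>k\<le>q. of_bool (k = 0) * y ^ k) = (1 :: 'k)"
    by (subst sum.mono_neutral_right[of _ "{0}"]) auto
  ultimately show ?thesis
    by (simp only: q lessThan_Suc_atMost left_diff_distrib sum_subtractf diff_Suc_1) (simp add: mult_ac)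
qed

text \<open>On \<open>F\<close> the expression is exactly the indicator, because nonzero
  \<open>d\<close> in \<open>F\<close> satisfy \<open>d ^ (Q - 1) = 1\<close>. Replacing
  \<open>c\<close> by the congruent \<open>y\<close> costs at most \<open>\<rho>\<close>.\<close>

lemma digit_indicator:
  assumes "c \<in> F" "a \<in> F" "y \<in> \<O>" "av (y - c) \<le> \<rho>"
  shows "av ((1 - (y - a) ^ (Q - 1)) - of_bool (c = a)) \<le> \<rho>" "1 - (y - a) ^ (Q - 1) \<in> \<O>"
proof -
  have O: "y - a \<in> \<O>" "c - a \<in> \<O>" using assms F_subset_O by auto
  have eq: "1 - (c - a) ^ (Q - 1) = of_bool (c = a)"
    using F_nonzero_power[of "c - a"] F_diff[OF assms(1,2)] Q_ge_2 by (auto simp: power_0_left)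
  have "av ((y - a) ^ (Q - 1) - (c - a) ^ (Q - 1)) \<le> \<rho>"
    using assms(4) O by (intro av_diff_power_le) auto
  then show "av ((1 - (y - a) ^ (Q - 1)) - of_bool (c = a)) \<le> \<rho>"
    unfolding eq[symmetric] by (simp add: av_diff_commute)
  show "1 - (y - a) ^ (Q - 1) \<in> \<O>" using O by auto
qed

text \<open>Each factor has degree below \<open>Q\<close> in \<open>D j\<close>, which is exactly
  the range of exponents that digit products allow; integral coefficients keep the later coefficient
  bound.\<close>

lemma indicator_span:
  assumes a: "a \<in> {..<n} \<rightarrow>\<^sub>E F"
  obtains c where "\<And>i. c i \<in> \<O>"
    "\<And>x. (\<Prod>j<n. 1 - (D j x - a j) ^ (Q - 1)) = (\<Sum>i<Q ^ n. c i * digit_ext Q D i x)"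
proof -
  \<comment> \<open>Beyond position \<open>n\<close> the string \<open>a\<close> is undefined; zero
    there secures integrality for every \<open>j\<close>.\<close>
  define b where "b = (\<lambda>j k. if j < n then
      of_bool (k = 0) - of_nat ((Q - 1) choose k) * (- a j) ^ (Q - 1 - k) else 0)"
  have "b j k \<in> \<O>" for j k
  proof (cases "j < n")
    case True
    then have "- a j \<in> \<O>" using a F_subset_O by auto
    then show ?thesis using True by (auto simp: b_def)
  qed (simp add: b_def)
  from digit_ext_span[where b = b and n = n and e = D, OF Q_ge_2 this] obtain c where
    c: "\<And>i. c i \<in> \<O>" "\<And>x. (\<Prod>j<n. \<Sum>k<Q. b j k * D j x ^ k) = (\<Sum>i<Q ^ n. c i * digit_ext Q D i x)"
    by blast
  have "(\<Prod>j<n. \<Sum>k<Q. b j k * D j x ^ k) = (\<Prod>j<n. 1 - (D j x - a j) ^ (Q - 1))" for x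
    by (intro prod.cong refl) (simp only: digit_indicator_expand b_def lessThan_iff if_True)
  then show thesis using c by (intro that[of c]) auto
qed

lemma indicator_prod:
  assumes x: "x \<in> \<O>" and a: "a \<in> {..<n} \<rightarrow>\<^sub>E F" and c: "c \<in> {..<n} \<rightarrow>\<^sub>E F"
    and xc: "\<And>j. j < n \<Longrightarrow> av (D j x - c j) \<le> \<rho>"
  shows "av ((\<Prod>j<n. 1 - (D j x - a j) ^ (Q - 1)) - of_bool (a = c)) \<le> \<rho>"
proof -
  have "(\<Prod>j<n. of_bool (c j = a j)) = (of_bool (a = c) :: 'k)"
  proof (cases "a = c")
    case False
    then obtain j where "j < n" "c j \<noteq> a j" using PiE_ext[OF a c] by fastforce
    then have "(\<Prod>j<n. of_bool (c j = a j)) = (0 :: 'k)" by (intro prod_zero) auto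
    then show ?thesis using False by simp
  qed simp
  moreover have "av ((\<Prod>j<n. 1 - (D j x - a j) ^ (Q - 1)) - (\<Prod>j<n. of_bool (c j = a j))) \<le> \<rho>"
  proof (rule av_diff_prod_le[THEN conjunct1])
    fix j assume "j \<in> {..<n}"
    then have "c j \<in> F" "a j \<in> F" "av (D j x - c j) \<le> \<rho>" using a c xc by auto
    from digit_indicator[OF this(1,2) D_in_O[OF x] this(3)]
    show "av (1 - (D j x - a j) ^ (Q - 1) - of_bool (c j = a j)) \<le> \<rho>"
      "1 - (D j x - a j) ^ (Q - 1) \<in> \<O>" .
  qed (use \<rho> in auto)
  ultimately show ?thesis by simp
qed

lemma digit_ext_continuous: "av_continuous_on av \<O> (digit_ext Q D i)"
  using av_continuous_on_prod[of "{..i}" "\<lambda>j x. D j x ^ ((i div Q ^ j) mod Q)"]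
  by (simp add: digit_ext_def[abs_def] av_continuous_on_power D_continuous)

lemma digit_ext_in_O: "x \<in> \<O> \<Longrightarrow> digit_ext Q D i x \<in> \<O>"
  by (auto simp: digit_ext_def intro: D_in_O)

lemma digit_ext_orthonormal_basis: "orthonormal_basis av (cont_fun_space av) (digit_ext Q D)"
proof (rule orthonormal_basisI[where \<rho> = \<rho>])
  show "\<exists>B. \<forall>x\<in>\<O>. av (f x) \<le> B" if "f \<in> cont_fun_space av" for f
    using that by (intro continuous_bounded) (simp add: cont_fun_space_def)
  show "(\<lambda>x. f x - (\<Sum>i<N. c i * digit_ext Q D i x)) \<in> cont_fun_space av"
    if "f \<in> cont_fun_space av" for f c N
    using that unfolding cont_fun_space_def
    by (auto intro!: av_continuous_on_diff av_continuous_on_sum av_continuous_on_mult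
        av_continuous_on_const digit_ext_continuous)
next
  fix f B assume "f \<in> cont_fun_space av" and B: "(B :: real) > 0" and f_le: "\<forall>x\<in>\<O>. av (f x) \<le> B"
  then have f: "av_continuous_on av \<O> f" by (simp add: cont_fun_space_def)
  obtain n where n: "\<And>x y. x \<in> \<O> \<Longrightarrow> y \<in> \<O> \<Longrightarrow> av (x - y) \<le> \<rho> ^ n \<Longrightarrow> av (f x - f y) \<le> \<rho> * B"
    using uniform_continuity[OF f, of "\<rho> * B"] B \<rho> by auto
  define A where "A = ({..<n} \<rightarrow>\<^sub>E F)"
  define s where "s = (\<lambda>a. \<Sum>m<n. a m * t ^ m)"
  have s: "s a \<in> \<O>" if "a \<in> A" for a using that digit_sum_in_O by (simp add: A_def s_def)
  define I where "I = (\<lambda>a x. \<Prod>j<n. 1 - (D j x - a j) ^ (Q - 1))"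
  have "\<exists>c. (\<forall>i. c i \<in> \<O>) \<and> (\<forall>x. I a x = (\<Sum>i<Q ^ n. c i * digit_ext Q D i x))" if "a \<in> A" for a
    by (rule indicator_span[OF that[unfolded A_def]]) (auto simp: I_def)
  then obtain C where C: "\<And>a i. a \<in> A \<Longrightarrow> C a i \<in> \<O>"
    "\<And>a x. a \<in> A \<Longrightarrow> I a x = (\<Sum>i<Q ^ n. C a i * digit_ext Q D i x)"
    by metis
  \<comment> \<open>These are the coefficients of \<open>\<Sum>a\<in>A. f (s a) * I a x\<close>, the
    step function interpolating \<open>f\<close> at the representatives with true indicators
    replaced by \<open>I a\<close>.\<close>
  define c where "c = (\<lambda>i. if i < Q ^ n then \<Sum>a\<in>A. f (s a) * C a i else 0)"
  have "av (\<Sum>a\<in>A. f (s a) * C a i) \<le> B" for i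
    using C(1) f_le s B by (intro av_sum_le av_mult_le_left) (auto simp flip: mem_O)
  then have c_le: "av (c i) \<le> B" for i using B by (simp add: c_def)
  have "(\<Sum>i<Q ^ n. c i * digit_ext Q D i x) = (\<Sum>a\<in>A. f (s a) * I a x)" for x
  proof -
    have "(\<Sum>i<Q ^ n. c i * digit_ext Q D i x) = (\<Sum>i<Q ^ n. \<Sum>a\<in>A. f (s a) * (C a i * digit_ext Q D i x))"
      by (intro sum.cong refl) (simp add: c_def sum_distrib_right mult.assoc)
    also have "\<dots> = (\<Sum>a\<in>A. f (s a) * I a x)"
      by (subst sum.swap) (simp add: C(2) sum_distrib_left)
    finally show ?thesis .
  qed
  moreover have "av (f x - (\<Sum>a\<in>A. f (s a) * I a x)) \<le> \<rho> * B" if x: "x \<in> \<O>" for x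
  proof -
    obtain b where b: "b \<in> A" "av (x - s b) \<le> \<rho> ^ n" "\<And>j. j < n \<Longrightarrow> av (D j x - b j) \<le> \<rho>"
      using digits_PiE[OF x, of n] unfolding A_def s_def by blast
    \<comment> \<open>Writing the value as a sum over all classes permits termwise comparison with
      the approximate indicators; the ultrametric inequality makes the number of classes
      irrelevant.\<close>
    have "f (s b) = (\<Sum>a\<in>A. f (s a) * of_bool (a = b))"
      using b(1) finite_digit_functions[of n] by (simp add: A_def)
    then have "f x - (\<Sum>a\<in>A. f (s a) * I a x) =
        (f x - f (s b)) - (\<Sum>a\<in>A. (I a x - of_bool (a = b)) * f (s a))"
      by (simp add: right_diff_distrib sum_subtractf mult.commute[of _ "f _"])
    moreover have "av (f x - f (s b)) \<le> \<rho> * B" using n[OF x s[OF b(1)] b(2)] .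
    moreover have "av (\<Sum>a\<in>A. (I a x - of_bool (a = b)) * f (s a)) \<le> \<rho> * B"
      using indicator_prod[OF x _ _ b(3)] b(1) f_le s \<rho> B
      by (intro av_sum_le av_mult_le) (auto simp: A_def I_def)
    ultimately show ?thesis using av_diff_le by (simp only:)
  qed
  ultimately show "\<exists>c N. (\<forall>i\<ge>N. c i = 0) \<and> (\<forall>i. av (c i) \<le> B) \<and>
      (\<forall>x\<in>\<O>. av (f x - (\<Sum>i<N. c i * digit_ext Q D i x)) \<le> \<rho> * B)"
    using c_le by (intro exI[of _ c] exI[of _ "Q ^ n"]) (auto simp: c_def)
qed (auto intro: digit_ext_in_O \<rho> simp: cont_fun_space_def digit_ext_continuous)

end

theorem theorem5p8:
  fixes \<pi> :: "'a::{finite,field} poly"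
    and av :: "'k::field \<Rightarrow> real"
    and \<iota> :: "'a poly \<Rightarrow> 'k"
  assumes "irreducible \<pi>"
    and "pi_adic_completion \<pi> av \<iota>"
  shows "orthonormal_basis av (cont_lin_space av (card (UNIV :: 'a set) ^ degree \<pi>)) (hyperdiff_ext av \<iota>)
       \<and> orthonormal_basis av (cont_fun_space av)
           (digit_ext (card (UNIV :: 'a set) ^ degree \<pi>) (hyperdiff_ext av \<iota>))"
proof -
  interpret pi_adic_field \<pi> av \<iota>
    using assms by unfold_locales
  show ?thesis using hyperdiff_orthonormal_basis digit_ext_orthonormal_basis by blast
qed

end
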